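(* Assume: (i) $F$ is bounded from below, strictly convex and Fréchet differentiable on $Y$, and $\nabla F:Y\to Y$ is Lipschitz continuous on compact sets; (ii) for every $\alpha\ge 0$ the sublevel set $\{u\in\mathcal M : \mathcal G(u)\le\alpha\}$ is weak* compact; (iii) whenever $\{u_k\}_k\subset\operatorname{dom}(\mathcal G)$ and $u_k\rightharpoonup^* u$ for some $u\in\mathcal M$, then $Ku_k\to Ku$ strongly in $Y$. Let $\mathcal A^\mu_k=\{u^k_i\}_{i=1}^{N_k}$ and $\mu_k\in M^+(\mathcal A^\mu_k)$ be given. Set $\mathcal A^u_k:=\mathcal A^\mu_k$ and $u_k:=\mathcal I(\mu_k)$. Then the update steps (a)-(e) of the FC-GCG algorithm and of the PDAP algorithm (both described in the context) can be realized such that $$\widehat v^u_k=\widehat v^\mu_k,\qquad u_{k+1}=\mathcal I(\mu_{k+1}),\qquad \mathcal A^u_{k+1}=\mathcal A^\mu_{k+1}.$$ In particular, if $\{u_k\}_k$ and $\{\mathcal A^u_k\}_k$ are sequences of iterates and active sets generated by the FC-GCG algorithm and we have $u_0=\mathcal I(\mu_0)$, $\mathcal A^u_0=\mathcal A^\mu_0$, then there exist sequences $\{\mu_k\}_k$ and $\{\mathcal A^\mu_k\}_k$ generated by the PDAP algorithm such that $$u_k=\mathcal I(\mu_k),\quad \mathcal A^u_k=\mathcal A^\mu_k,\quad \widehat v^u_k=\widehat v^\mu_k,$$ and it holds $$0\le r_J(u_k)\le r_j(\mu_k)\qquad\text{for all }k\in\mathbb N,$$ where $r_J(u_k)=J(u_k)-\min_{u\in\mathcal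 M}J(u)$ and $r_j(\mu_k)=j(\mu_k)-\min_{\mu\in M^+(\mathcal B)}j(\mu)$.
   Context: Setting: $\mathcal C$ is a separable real Banach space, $\mathcal M=\mathcal C^*$ its topological dual with the dual norm, $\langle p,u\rangle$ denotes the duality pairing. $Y$ is a real Hilbert space, $F:Y\to\mathbb R$ is convex, $K:\mathcal M\to Y$ is linear and weak*-to-weak continuous with continuous pre-adjoint $K_*:Y\to\mathcal C$, $\langle K_*y,u\rangle=(Ku,y)_Y$. $\mathcal G:\mathcal M\to[0,\infty]$ is convex, weak* lower semicontinuous and positively one-homogeneous. $J(u)=F(Ku)+\mathcal G(u)$; $\operatorname{dom}(\mathcal G)=\{u:\mathcal G(u)<\infty\}$; $B=\{u\in\mathcal M:\mathcal G(u)\le1\}$; $\operatorname{Ext}(B)$ is its set of extremal points; $\mathcal B=\overline{\operatorname{Ext}(B)}^{*}$ (weak* closure), compact metrizable in the weak* topology. $M(\mathcal B)=C(\mathcal B)^*$ is the space of finite Radon measures on $\mathcal B$ with total variation norm, $M^+(\mathcal B)$ the positive ones. $\mathcal I:M^+(\mathcal B)\to\operatorname{dom}(\mathcal G)$ is determined by $\langle p,\mathcal I(\mu)\rangle=\int_{\mathcal B}\langle p,v\rangle\,d\mu(v)$ for all $p\in\mathcal C$. $\mathcal K:M(\mathcal B)\to Y$ is the linear continuous operator with $(\mathcal K\mu,y)_Y=\int_{\mathcal B}(Kv,y)_Y\,d\mu(v)$ for all $y\in Y$; it is the adjoint of $\mathcal K_*:Y\to C(\mathcal B)$, $[\mathcal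 K_*y](v)=\langle K_*y,v\rangle$. $j(\mu)=F(\mathcal K\mu)+\|\mu\|_{M(\mathcal B)}$ for $\mu\in M^+(\mathcal B)$. For a finite family $\mathcal A=\{u_i\}_{i=1}^n\subset\operatorname{Ext}(B)$, $M^+(\mathcal A)=\{\sum_{i=1}^n\lambda_i\delta_{u_i}:\lambda_i\ge0\}$ and $\operatorname{cone}(\mathcal A)=\{\sum_{i=1}^n\lambda_iu_i:\lambda_i\ge0\}$. FC-GCG algorithm. Initialize with $\mathcal A^u_0=\{u^0_i\}_{i=1}^{N_0}\subset\operatorname{Ext}(B)$ and $u_0=\sum_{i=1}^{N_0}\lambda^0_iu^0_i$, $\lambda^0_i>0$. For $k=0,1,2,\dots$: (a) given $\mathcal A^u_k=\{u^k_i\}_{i=1}^{N_k}\subset\operatorname{Ext}(B)$ and $u_k\in\operatorname{cone}(\mathcal A^u_k)$, compute $p_k=-K_*\nabla F(Ku_k)$ and $\widehat v^u_k\in\arg\max_{v\in\operatorname{Ext}(B)}\langle p_k,v\rangle$; (b) if $\langle p_k,\widehat v^u_k\rangle\le1$ and $k\ge1$, terminate with $u_k$; (c) set $N_k^+=N_k+1$, $u^k_{N_k^+}=\widehat v^u_k$ and $\mathcal A^{u,+}_k=\mathcal A^u_k\cup\{\widehat v^u_k\}$; (d) choose $\lambda^{k+1}\in\arg\min_{\lambda\in[0,\infty)^{N_k^+}}\big[F\big(\sum_{i=1}^{N_k^+}\lambda_iKu^k_i\big)+\sum_{i=1}^{N_k^+}\lambda_i\big]$ and set $u_{k+1}=\sum_{i=1}^{N_k^+}\lambda^{k+1}_iu^k_i$;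 (e) set $\mathcal A^u_{k+1}=\mathcal A^{u,+}_k\setminus\{u^k_i:\lambda^{k+1}_i=0,\ i=1,\dots,N_k^+\}$ and $N_{k+1}=\#\mathcal A^u_{k+1}$. PDAP algorithm. Initialize with $\mathcal A^\mu_0=\{u^0_i\}_{i=1}^{N_0}\subset\operatorname{Ext}(B)$ and $\mu_0=\sum_{i=1}^{N_0}\lambda^0_i\delta_{u^0_i}$, $\lambda^0_i>0$. For $k=0,1,2,\dots$: (a) given $\mathcal A^\mu_k=\{u^k_i\}_{i=1}^{N_k}\subset\operatorname{Ext}(B)$ and $\mu_k\in M^+(\mathcal A^\mu_k)$, compute $P_k=-\mathcal K_*\nabla F(\mathcal K\mu_k)\in C(\mathcal B)$ and $\widehat v^\mu_k\in\arg\max_{v\in\operatorname{Ext}(B)}P_k(v)$; (b) if $P_k(\widehat v^\mu_k)\le1$ and $k\ge1$, terminate with $\mu_k$; (c) set $N_k^+=N_k+1$, $u^k_{N_k^+}=\widehat v^\mu_k$ and $\mathcal A^{\mu,+}_k=\mathcal A^\mu_k\cup\{\widehat v^\mu_k\}$; (d) choose $\mu_{k+1}\in\arg\min_{\mu\in M^+(\mathcal A^{\mu,+}_k)}\big[F(\mathcal K\mu)+\|\mu\|_{M(\mathcal B)}\big]$; (e) set $\mathcal A^\mu_{k+1}=\operatorname{supp}\mu_{k+1}$ and $N_{k+1}=\#\mathcal A^\mu_{k+1}$. *)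

theory Defs
  imports "HOL-Probability.Probability"
begin

section \<open>Functional analytic notions\<close>

type_synonym 'c dual = "'c \<Rightarrow>\<^sub>L real"

text \<open>For functionals, pointwise convergence on the predual is weak* convergence, so the
  weak* topology is the instance at codomain \<open>real\<close> of the library's strong operator topology.\<close>
abbreviation weak_star :: "('c::real_normed_vector dual) topology" where
  "weak_star \<equiv> strong_operator_topology"

text \<open>The coarsest topology making all bounded linear functionals continuous.\<close>
definition weak_topology :: "('y::real_normed_vector) topology" where
  "weak_topology = pullback_topology UNIV (\<lambda>y (f :: 'y dual). blinfun_apply f y) euclidean"

definition strictly_convex :: "('y::real_vector \<Rightarrow> real) \<Rightarrow> bool" where
  "strictly_convex F \<longleftrightarrow>
    (\<forall>x y t. x \<noteq> y \<longrightarrow> 0 < t \<longrightarrow> t < 1 \<longrightarrow>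
      F ((1 - t) *\<^sub>R x + t *\<^sub>R y) < (1 - t) * F x + t * F y)"

definition gradient :: "('y::real_inner \<Rightarrow> real) \<Rightarrow> 'y \<Rightarrow> 'y" where
  "gradient F y = (THE g. GDERIV F y :> g)"

text \<open>In the extended nonnegative reals \<open>0 * \<infinity> = 0\<close>; hence the endpoint cases below are
  harmless, and one-homogeneity includes the normalisation \<open>G 0 = 0\<close>.\<close>
definition ennreal_convex :: "('u::real_vector \<Rightarrow> ennreal) \<Rightarrow> bool" where
  "ennreal_convex G \<longleftrightarrow>
    (\<forall>u v t. 0 \<le> t \<longrightarrow> t \<le> 1 \<longrightarrow>
      G ((1 - t) *\<^sub>R u + t *\<^sub>R v) \<le> ennreal (1 - t) * G u + ennreal t * G v)"

definition positively_homogeneous :: "('u::real_vector \<Rightarrow> ennreal) \<Rightarrow> bool" where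
  "positively_homogeneous G \<longleftrightarrow> (\<forall>u t. 0 \<le> t \<longrightarrow> G (t *\<^sub>R u) = ennreal t * G u)"

definition weak_star_lsc :: "('c::real_normed_vector dual \<Rightarrow> ennreal) \<Rightarrow> bool" where
  "weak_star_lsc G \<longleftrightarrow> (\<forall>a. closedin weak_star {u. G u \<le> a})"

text \<open>The value \<open>min {f x | x. P x}\<close>; it is unspecified if the minimum is not attained.\<close>
definition min_value :: "('a \<Rightarrow> 'b::linorder) \<Rightarrow> ('a \<Rightarrow> bool) \<Rightarrow> 'b" where
  "min_value f P = f (arg_min f P)"


section \<open>The extremal points and measures on their closure\<close>

definition Ext :: "('c::real_normed_vector dual \<Rightarrow> ennreal) \<Rightarrow> 'c dual set" where
  "Ext G = {v. v extreme_point_of {u. G u \<le> 1}}"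

definition clExt :: "('c::real_normed_vector dual \<Rightarrow> ennreal) \<Rightarrow> 'c dual set" where
  "clExt G = weak_star closure_of Ext G"

definition borel_clExt :: "('c::real_normed_vector dual \<Rightarrow> ennreal) \<Rightarrow> 'c dual measure" where
  "borel_clExt G = sigma (clExt G) {U. openin (subtopology weak_star (clExt G)) U}"

text \<open>Positive finite measures. Under the standing assumptions \<^term>\<open>clExt G\<close> is compact and
  metrizable in the weak* topology, so that every finite Borel measure on it is Radon.\<close>
definition Mpos :: "('c::real_normed_vector dual \<Rightarrow> ennreal) \<Rightarrow> 'c dual measure set" where
  "Mpos G = {\<mu>. sets \<mu> = sets (borel_clExt G) \<and> finite_measure \<mu>}"

text \<open>On positive measures the total variation norm is the total mass.\<close>
definition mass :: "'u measure \<Rightarrow> real" where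
  "mass \<mu> = measure \<mu> (space \<mu>)"

text \<open>\<open>\<mu> = (\<Sum>w\<in>A. c w \<cdot> \<delta>\<^sub>w)\<close>\<close>
definition dirac_comb ::
  "('c::real_normed_vector dual \<Rightarrow> ennreal) \<Rightarrow> 'c dual set \<Rightarrow> ('c dual \<Rightarrow> real) \<Rightarrow> 'c dual measure \<Rightarrow> bool"
where
  "dirac_comb G A c \<mu> \<longleftrightarrow> \<mu> \<in> Mpos G \<and>
    (\<forall>E \<in> sets \<mu>. emeasure \<mu> E = (\<Sum>w\<in>A. ennreal (c w) * emeasure (return (borel_clExt G) w) E))"

definition Mpos_on ::
  "('c::real_normed_vector dual \<Rightarrow> ennreal) \<Rightarrow> 'c dual set \<Rightarrow> 'c dual measure set" where
  "Mpos_on G A = {\<mu>. \<exists>c. (\<forall>w\<in>A. 0 \<le> c w) \<and> dirac_comb G A c \<mu>}"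

definition msupp ::
  "('c::real_normed_vector dual \<Rightarrow> ennreal) \<Rightarrow> 'c dual measure \<Rightarrow> 'c dual set" where
  "msupp G \<mu> = {v \<in> clExt G.
    \<forall>U. openin (subtopology weak_star (clExt G)) U \<longrightarrow> v \<in> U \<longrightarrow> 0 < emeasure \<mu> U}"

definition Iop :: "'c::real_normed_vector dual measure \<Rightarrow> 'c dual" where
  "Iop \<mu> = (THE u. \<forall>p. blinfun_apply u p = (\<integral>v. blinfun_apply v p \<partial>\<mu>))"

definition Kop ::
  "('c::real_normed_vector dual \<Rightarrow> 'y::real_inner) \<Rightarrow> 'c dual measure \<Rightarrow> 'y" where
  "Kop K \<mu> = (THE z. \<forall>y. inner z y = (\<integral>v. inner (K v) y \<partial>\<mu>))"

definition Kop_pre :: "('y \<Rightarrow> 'c::real_normed_vector) \<Rightarrow> 'y \<Rightarrow> 'c dual \<Rightarrow> real" where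
  "Kop_pre Kp y = (\<lambda>v. blinfun_apply v (Kp y))"


section \<open>Objectives and residuals\<close>

definition J_obj ::
  "('y::real_inner \<Rightarrow> real) \<Rightarrow> ('c::real_normed_vector dual \<Rightarrow> 'y) \<Rightarrow> ('c dual \<Rightarrow> ennreal) \<Rightarrow>
   'c dual \<Rightarrow> ereal" where
  "J_obj F K G u = ereal (F (K u)) + enn2ereal (G u)"

definition j_obj ::
  "('y::real_inner \<Rightarrow> real) \<Rightarrow> ('c::real_normed_vector dual \<Rightarrow> 'y) \<Rightarrow> 'c dual measure \<Rightarrow> real" where
  "j_obj F K \<mu> = F (Kop K \<mu>) + mass \<mu>"

definition rJ ::
  "('y::real_inner \<Rightarrow> real) \<Rightarrow> ('c::real_normed_vector dual \<Rightarrow> 'y) \<Rightarrow> ('c dual \<Rightarrow> ennreal) \<Rightarrow>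
   'c dual \<Rightarrow> ereal" where
  "rJ F K G u = J_obj F K G u - min_value (J_obj F K G) (\<lambda>_. True)"

definition rj ::
  "('y::real_inner \<Rightarrow> real) \<Rightarrow> ('c::real_normed_vector dual \<Rightarrow> 'y) \<Rightarrow> ('c dual \<Rightarrow> ennreal) \<Rightarrow>
   'c dual measure \<Rightarrow> real" where
  "rj F K G \<mu> = j_obj F K \<mu> - min_value (j_obj F K) (\<lambda>\<nu>. \<nu> \<in> Mpos G)"


section \<open>The FC-GCG algorithm\<close>

text \<open>Active sets are finite sets of pairwise distinct points, and coefficients are attached to
  points. In particular, if the new point already belongs to the active set, the latter does
  not grow. A run is described by its last index \<open>T\<close>, which is \<open>\<infinity>\<close> if the algorithm does not
  terminate; sequence entries beyond \<open>T\<close> are irrelevant.\<close>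

definition fcgcg_p ::
  "('y::real_inner \<Rightarrow> real) \<Rightarrow> ('c::real_normed_vector dual \<Rightarrow> 'y) \<Rightarrow> ('y \<Rightarrow> 'c) \<Rightarrow> 'c dual \<Rightarrow> 'c" where
  "fcgcg_p F K Kp u = - Kp (gradient F (K u))"

definition fcgcg_select ::
  "('y::real_inner \<Rightarrow> real) \<Rightarrow> ('c::real_normed_vector dual \<Rightarrow> 'y) \<Rightarrow> ('y \<Rightarrow> 'c) \<Rightarrow>
   ('c dual \<Rightarrow> ennreal) \<Rightarrow> 'c dual \<Rightarrow> 'c dual \<Rightarrow> bool" where
  "fcgcg_select F K Kp G u v \<longleftrightarrow>
    is_arg_max (\<lambda>w. blinfun_apply w (fcgcg_p F K Kp u)) (\<lambda>w. w \<in> Ext G) v"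

definition fcgcg_stop ::
  "('y::real_inner \<Rightarrow> real) \<Rightarrow> ('c::real_normed_vector dual \<Rightarrow> 'y) \<Rightarrow> ('y \<Rightarrow> 'c) \<Rightarrow>
   nat \<Rightarrow> 'c dual \<Rightarrow> 'c dual \<Rightarrow> bool" where
  "fcgcg_stop F K Kp k u v \<longleftrightarrow> blinfun_apply v (fcgcg_p F K Kp u) \<le> 1 \<and> k \<ge> 1"

definition fcgcg_update ::
  "('y::real_inner \<Rightarrow> real) \<Rightarrow> ('c::real_normed_vector dual \<Rightarrow> 'y) \<Rightarrow>
   'c dual set \<Rightarrow> 'c dual \<Rightarrow> 'c dual \<Rightarrow> 'c dual set \<Rightarrow> bool" where
  "fcgcg_update F K A v u' A' \<longleftrightarrow>
    (let Ap = A \<union> {v} in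
      \<exists>c. is_arg_min (\<lambda>c. F (\<Sum>w\<in>Ap. c w *\<^sub>R K w) + (\<Sum>w\<in>Ap. c w)) (\<lambda>c. \<forall>w\<in>Ap. 0 \<le> c w) c
        \<and> u' = (\<Sum>w\<in>Ap. c w *\<^sub>R w)
        \<and> A' = Ap - {w \<in> Ap. c w = 0})"

definition fcgcg_init ::
  "('c::real_normed_vector dual \<Rightarrow> ennreal) \<Rightarrow> 'c dual set \<Rightarrow> 'c dual \<Rightarrow> bool" where
  "fcgcg_init G A u \<longleftrightarrow> finite A \<and> A \<subseteq> Ext G \<and>
    (\<exists>c. (\<forall>w\<in>A. 0 < c w) \<and> u = (\<Sum>w\<in>A. c w *\<^sub>R w))"

definition fcgcg_run ::
  "('y::real_inner \<Rightarrow> real) \<Rightarrow> ('c::real_normed_vector dual \<Rightarrow> 'y) \<Rightarrow> ('y \<Rightarrow> 'c) \<Rightarrow>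
   ('c dual \<Rightarrow> ennreal) \<Rightarrow> enat \<Rightarrow>
   (nat \<Rightarrow> 'c dual set) \<Rightarrow> (nat \<Rightarrow> 'c dual) \<Rightarrow> (nat \<Rightarrow> 'c dual) \<Rightarrow> bool" where
  "fcgcg_run F K Kp G T A u v \<longleftrightarrow>
    fcgcg_init G (A 0) (u 0) \<and>
    (\<forall>k. enat k \<le> T \<longrightarrow> fcgcg_select F K Kp G (u k) (v k)) \<and>
    (\<forall>k. enat k \<le> T \<longrightarrow> (fcgcg_stop F K Kp k (u k) (v k) \<longleftrightarrow> T = enat k)) \<and>
    (\<forall>k. enat k < T \<longrightarrow> fcgcg_update F K (A k) (v k) (u (Suc k)) (A (Suc k)))"


section \<open>The PDAP algorithm\<close>

definition pdap_P ::
  "('y::real_inner \<Rightarrow> real) \<Rightarrow> ('c::real_normed_vector dual \<Rightarrow> 'y) \<Rightarrow> ('y \<Rightarrow> 'c) \<Rightarrow>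
   'c dual measure \<Rightarrow> 'c dual \<Rightarrow> real" where
  "pdap_P F K Kp \<mu> = (\<lambda>v. - Kop_pre Kp (gradient F (Kop K \<mu>)) v)"

definition pdap_select ::
  "('y::real_inner \<Rightarrow> real) \<Rightarrow> ('c::real_normed_vector dual \<Rightarrow> 'y) \<Rightarrow> ('y \<Rightarrow> 'c) \<Rightarrow>
   ('c dual \<Rightarrow> ennreal) \<Rightarrow> 'c dual measure \<Rightarrow> 'c dual \<Rightarrow> bool" where
  "pdap_select F K Kp G \<mu> v \<longleftrightarrow> is_arg_max (pdap_P F K Kp \<mu>) (\<lambda>w. w \<in> Ext G) v"

definition pdap_stop ::
  "('y::real_inner \<Rightarrow> real) \<Rightarrow> ('c::real_normed_vector dual \<Rightarrow> 'y) \<Rightarrow> ('y \<Rightarrow> 'c) \<Rightarrow>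
   nat \<Rightarrow> 'c dual measure \<Rightarrow> 'c dual \<Rightarrow> bool" where
  "pdap_stop F K Kp k \<mu> v \<longleftrightarrow> pdap_P F K Kp \<mu> v \<le> 1 \<and> k \<ge> 1"

definition pdap_update ::
  "('y::real_inner \<Rightarrow> real) \<Rightarrow> ('c::real_normed_vector dual \<Rightarrow> 'y) \<Rightarrow> ('c dual \<Rightarrow> ennreal) \<Rightarrow>
   'c dual set \<Rightarrow> 'c dual \<Rightarrow> 'c dual measure \<Rightarrow> 'c dual set \<Rightarrow> bool" where
  "pdap_update F K G A v \<mu>' A' \<longleftrightarrow>
    is_arg_min (j_obj F K) (\<lambda>\<mu>. \<mu> \<in> Mpos_on G (A \<union> {v})) \<mu>' \<and> A' = msupp G \<mu>'"

definition pdap_init ::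
  "('c::real_normed_vector dual \<Rightarrow> ennreal) \<Rightarrow> 'c dual set \<Rightarrow> 'c dual measure \<Rightarrow> bool" where
  "pdap_init G A \<mu> \<longleftrightarrow> finite A \<and> A \<subseteq> Ext G \<and>
    (\<exists>c. (\<forall>w\<in>A. 0 < c w) \<and> dirac_comb G A c \<mu>)"

definition pdap_run ::
  "('y::real_inner \<Rightarrow> real) \<Rightarrow> ('c::real_normed_vector dual \<Rightarrow> 'y) \<Rightarrow> ('y \<Rightarrow> 'c) \<Rightarrow>
   ('c dual \<Rightarrow> ennreal) \<Rightarrow> enat \<Rightarrow>
   (nat \<Rightarrow> 'c dual set) \<Rightarrow> (nat \<Rightarrow> 'c dual measure) \<Rightarrow> (nat \<Rightarrow> 'c dual) \<Rightarrow> bool" where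
  "pdap_run F K Kp G T A \<mu> v \<longleftrightarrow>
    pdap_init G (A 0) (\<mu> 0) \<and>
    (\<forall>k. enat k \<le> T \<longrightarrow> pdap_select F K Kp G (\<mu> k) (v k)) \<and>
    (\<forall>k. enat k \<le> T \<longrightarrow> (pdap_stop F K Kp k (\<mu> k) (v k) \<longleftrightarrow> T = enat k)) \<and>
    (\<forall>k. enat k < T \<longrightarrow> pdap_update F K G (A k) (v k) (\<mu> (Suc k)) (A (Suc k)))"

end

theory Submission
  imports Defs
begin

text \<open>For a Dirac combination \<open>\<mu> = (\<Sum>w\<in>A. c w \<cdot> \<delta>\<^sub>w)\<close> one has \<open>I \<mu> = (\<Sum>w\<in>A. c w w)\<close> and
  \<open>j \<mu> = F (\<Sum>w\<in>A. c w K w) + (\<Sum>w\<in>A. c w)\<close>, so the two coefficient problems coincide and a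
  GCG run lifts step by step. The substance lies in the residual bound, which needs
  \<open>min j \<le> min J\<close>: every point of the unit ball of \<open>G\<close> is the barycenter of a probability measure on
  the weak* closure of the extreme points. Conversely, the barycenter of a measure of mass \<open>t\<close>
  is \<open>t\<close> times a point of the unit ball, so that \<open>J (I \<mu>) \<le> j \<mu>\<close>.\<close>

section \<open>Compact convex sets in the weak* topology\<close>

text \<open>The obstacle is to produce a measure from a point of the unit ball. It is obtained as
  the law of a random point, so that countable additivity is inherited from the driving probability
  space instead of coming from a functional on continuous functions. All convexity is phrased
  through \<open>dominated_by X l\<close>, which says that \<open>l\<close> lies below the support
  function of \<open>X\<close>; for \<open>l = blinfun_apply u\<close> this means that
  \<open>u\<close> lies in the weak* closed convex hull of \<open>X\<close>. Bounds \<open>c\<close>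
  replace suprema, so that empty or unbounded sets need no convention. Continuity of
  \<open>l\<close> is not presupposed: on compact convex sets
  \<open>dominated_by_represented\<close> supplies the dual element. Separability enters through
  countably many coordinates. They drive the selection of extreme points, the extraction of weak*
  convergent subsequences and the cuts that shrink a set to a point. Since \<open>min_value\<close>
  is meaningful only for attained minima, comparing the minimal values requires minimisers of both
  problems.\<close>

definition dominated_by :: "('c::real_normed_vector) dual set \<Rightarrow> ('c \<Rightarrow> real) \<Rightarrow> bool" where
  "dominated_by X l \<longleftrightarrow> (\<forall>p c. (\<forall>x\<in>X. blinfun_apply x p \<le> c) \<longrightarrow> l p \<le> c)"

lemma dominated_byD:
  "dominated_by X l \<Longrightarrow> (\<And>x. x \<in> X \<Longrightarrow> blinfun_apply x p \<le> c) \<Longrightarrow> l p \<le> c"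
  by (simp add: dominated_by_def)

lemma dominated_by_nonempty:
  assumes "dominated_by X l" "linear l" shows "X \<noteq> {}"
  using dominated_byD[OF assms(1), of 0 "-1"] linear_0[OF assms(2)] by auto

section \<open>Evaluations, halfspaces and compactness in the weak* topology\<close>

lemma Hausdorff_weak_star: "Hausdorff_space (weak_star :: ('c::real_normed_vector dual) topology)"
proof (rule Hausdorff_space_injective_preimage)
  show "continuous_map (weak_star :: 'c dual topology) euclidean blinfun_apply"
    using continuous_map_pullback[of euclidean euclidean id UNIV blinfun_apply]
    by (simp add: strong_operator_topology_def)
  show "Hausdorff_space (euclidean :: ('c \<Rightarrow> real) topology)"
    unfolding euclidean_product_topology[symmetric] Hausdorff_space_product_topology by simp
qed (auto intro: inj_onI simp: blinfun_apply_inject)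

lemmas continuous_map_eval = strong_operator_topology_continuous_evaluation

lemma closedin_weak_star_le: "closedin weak_star {u. blinfun_apply u p \<le> (c::real)}"
  using closedin_continuous_map_preimage[OF continuous_map_eval[of p], of "{..c}"]
  by (simp add: strong_operator_topology_topspace)

lemma closedin_weak_star_ge: "closedin weak_star {u. (c::real) \<le> blinfun_apply u p}"
  using closedin_continuous_map_preimage[OF continuous_map_eval[of p], of "{c..}"]
  by (simp add: strong_operator_topology_topspace)

lemma closedin_weak_star_eq: "closedin weak_star {u. blinfun_apply u p = (c::real)}"
  using closedin_continuous_map_preimage[OF continuous_map_eval[of p], of "{c}"]
  by (simp add: strong_operator_topology_topspace)

lemma compactin_weak_star_imp_closedin:
  "compactin weak_star (Q::('c::real_normed_vector) dual set) \<Longrightarrow> closedin weak_star Q"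
  using Hausdorff_weak_star compactin_imp_closedin by blast

lemma compactin_attains_inf:
  fixes f :: "'a \<Rightarrow> real"
  assumes "compactin X Q" "continuous_map X euclidean f" "Q \<noteq> {}"
  obtains u where "u \<in> Q" "\<And>v. v \<in> Q \<Longrightarrow> f u \<le> f v"
proof -
  have "compact (f ` Q)"
    using image_compactin[OF assms(1,2)] by simp
  from compact_attains_inf[OF this] show ?thesis
    using assms(3) that by blast
qed

lemma compactin_eval_bounded:
  assumes "compactin weak_star Q"
  obtains M where "\<And>u. u \<in> Q \<Longrightarrow> \<bar>blinfun_apply u p\<bar> \<le> (M::real)"
proof -
  have "compact ((\<lambda>u. blinfun_apply u p) ` Q)"
    using image_compactin[OF assms continuous_map_eval[of p]] by simp
  then show ?thesis
    using that compact_imp_bounded[THEN iffD1[OF bounded_iff]] by fastforce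
qed

lemma compactin_nest:
  assumes "compactin X Q" "\<And>n::nat. closedin X (C n)" "\<And>n. Q \<inter> C n \<noteq> {}" "decseq C"
  shows "Q \<inter> (\<Inter>n. C n) \<noteq> {}"
proof -
  have "(\<Inter>n. Q \<inter> C n) \<noteq> {}"
  proof (rule compact_space_imp_nest[of "subtopology X Q"])
    show "closedin (subtopology X Q) (Q \<inter> C n)" for n
      using assms(2) closedin_subtopology by fastforce
    show "decseq (\<lambda>n. Q \<inter> C n)" using assms(4) unfolding decseq_def by blast
  qed (use assms in \<open>auto simp: compact_space_subtopology\<close>)
  then show ?thesis by blast
qed

text \<open>A Hahn--Banach argument: by compactness it suffices to match finitely many values \<open>l p\<close>,
  and the best least-squares match is exact, by its variational inequality.\<close>
lemma dominated_by_represented: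
  assumes Q: "compactin weak_star Q" "convex Q" and l: "linear l" and dom: "dominated_by Q l"
  shows "\<exists>u\<in>Q. \<forall>p. blinfun_apply u p = l p"
proof -
  have ne: "Q \<noteq> {}" using dominated_by_nonempty[OF dom l] .
  let ?H = "\<lambda>p. {u. blinfun_apply u p = l p}"
  have fin: "Q \<inter> (\<Inter>p\<in>P. ?H p) \<noteq> {}" if P: "finite P" for P
  proof -
    define phi where "phi u = (\<Sum>p\<in>P. (blinfun_apply u p - l p)^2)" for u
    have "continuous_map weak_star euclidean phi"
      unfolding phi_def
      by (intro continuous_map_sum continuous_map_real_pow continuous_map_diff
          continuous_map_eval continuous_map_canonical_const P)
    then obtain u0 where u0: "u0 \<in> Q" "\<And>v. v \<in> Q \<Longrightarrow> phi u0 \<le> phi v"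
      using compactin_attains_inf[OF Q(1) _ ne] by blast
    define a where "a p = blinfun_apply u0 p - l p" for p
    \<comment> \<open>\<open>ps\<close> represents half the gradient of \<open>phi\<close> at
      \<open>u0\<close>: the derivative in the direction \<open>u - u0\<close> is
      \<open>2 * (blinfun_apply u ps - blinfun_apply u0 ps)\<close>.\<close>
    define ps where "ps = (\<Sum>p\<in>P. a p *\<^sub>R p)"
    have app: "blinfun_apply u ps = (\<Sum>p\<in>P. a p * blinfun_apply u p)" for u
      by (simp add: ps_def blinfun.sum_right blinfun.scaleR_right)
    have "blinfun_apply u0 ps \<le> blinfun_apply u ps" if u: "u \<in> Q" for u
    proof (rule ccontr)
      define D where "D = blinfun_apply u ps - blinfun_apply u0 ps"
      define E where "E = (\<Sum>p\<in>P. (blinfun_apply u p - blinfun_apply u0 p)^2)"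
      assume "\<not> ?thesis"
      then have D: "D < 0" by (simp add: D_def)
      have E: "0 \<le> E" by (simp add: E_def sum_nonneg)
      \<comment> \<open>Along the segment \<open>phi\<close> changes by
        \<open>2 * t * D + t^2 * E\<close>. This \<open>t\<close> gives
        \<open>t * E \<le> - D - t\<close>, hence \<open>2 * D + t * E < 0\<close>; the summand 1
        covers \<open>E = 0\<close>.\<close>
      define t where "t = min 1 (- D / (E + 1))"
      have t: "0 < t" "t \<le> 1" using D E by (auto simp: t_def divide_less_0_iff)
      define v where "v = (1 - t) *\<^sub>R u0 + t *\<^sub>R u"
      have v: "v \<in> Q" unfolding v_def using t u u0 Q(2) by (intro convexD_alt) auto
      have vp: "blinfun_apply v p = (1 - t) * blinfun_apply u0 p + t * blinfun_apply u p" for p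
        by (simp add: v_def blinfun.add_left blinfun.scaleR_left)
      have "phi v = (\<Sum>p\<in>P. (a p)^2 + (2 * t) * (a p * blinfun_apply u p - a p * blinfun_apply u0 p)
               + t^2 * (blinfun_apply u p - blinfun_apply u0 p)^2)"
        unfolding phi_def
        by (intro sum.cong)
          (simp_all only: vp a_def, algebra)
      also have "\<dots> = phi u0 + 2 * t * D + t^2 * E"
        by (simp add: sum.distrib sum_subtractf sum_distrib_left[symmetric] phi_def a_def[symmetric]
            D_def app E_def)
      finally have "0 \<le> t * (2 * D + t * E)" using u0(2)[OF v]
        by (simp add: power2_eq_square algebra_simps)
      then have "0 \<le> 2 * D + t * E" using t by (simp add: zero_le_mult_iff)
      moreover have "t \<le> - D / (E + 1)" by (simp add: t_def)
      then have "t * (E + 1) \<le> - D" using E by (subst (asm) pos_le_divide_eq) auto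
      ultimately show False using D t E by (simp only: distrib_left mult_1_right)
    qed
    \<comment> \<open>The variational inequality bounds \<open>- ps\<close> on \<open>Q\<close> by
      its value at \<open>u0\<close>, and domination carries the bound over to \<open>l\<close>. The
      difference \<open>blinfun_apply u0 ps - l ps\<close> is the squared error itself, which
      therefore vanishes.\<close>
    then have "l (- ps) \<le> - blinfun_apply u0 ps"
      by (intro dominated_byD[OF dom]) (auto simp: blinfun.minus_right)
    then have "blinfun_apply u0 ps - l ps \<le> 0" using linear_neg[OF l] by simp
    moreover have "blinfun_apply u0 ps - l ps = (\<Sum>p\<in>P. (a p)^2)"
      unfolding app unfolding ps_def
      by (simp add: linear_sum[OF l] linear_cmul[OF l] sum_subtractf[symmetric]
          right_diff_distrib[symmetric] a_def power2_eq_square)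
    ultimately have "(\<Sum>p\<in>P. (a p)^2) = 0" by (simp add: antisym sum_nonneg)
    then have "\<forall>p\<in>P. a p = 0" using P by (simp add: sum_nonneg_eq_0_iff)
    then show ?thesis using u0(1) by (auto simp: a_def)
  qed
  have "Q \<inter> \<Inter>(range ?H) \<noteq> {}"
  proof (rule Q(1)[unfolded compactin_fip, THEN conjunct2, rule_format], intro conjI ballI allI impI)
    show "closedin weak_star C" if "C \<in> range ?H" for C
      using that closedin_weak_star_eq by auto
    show "Q \<inter> \<Inter>\<F> \<noteq> {}" if F: "finite \<F> \<and> \<F> \<subseteq> range ?H" for \<F>
    proof -
      obtain P where "finite P" "\<F> = ?H ` P"
        using F finite_subset_image[of \<F> ?H UNIV] by auto
      then show ?thesis using fin by simp
    qed
  qed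
  then show ?thesis by auto
qed

text \<open>Continuous functionals that agree on a dense set coincide, so countably many evaluations
  serve as coordinates on the whole dual.\<close>

lemma separating_sequence:
  assumes "separable_space (euclidean :: ('c::real_normed_vector) topology)"
  obtains P :: "nat \<Rightarrow> 'c::real_normed_vector"
  where "\<And>u v :: 'c dual. (\<And>n. blinfun_apply u (P n) = blinfun_apply v (P n)) \<Longrightarrow> u = v"
proof -
  obtain C :: "'c set" where C: "countable C" "closure C = UNIV"
    using assms by (auto simp: separable_space_def)
  then have "C \<noteq> {}" by auto
  have "u = v" if eq: "\<And>n. blinfun_apply u (from_nat_into C n) = blinfun_apply v (from_nat_into C n)"
    for u v :: "'c dual"
  proof -
    have "\<forall>x\<in>C. blinfun_apply u x = blinfun_apply v x"
      using eq C(1) by (metis from_nat_into_surj)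
    moreover have "closed {x. blinfun_apply u x = blinfun_apply v x}"
      by (intro closed_Collect_eq) (auto intro!: continuous_intros)
    ultimately have "closure C \<subseteq> {x. blinfun_apply u x = blinfun_apply v x}"
      by (intro closure_minimal) auto
    then show ?thesis using C(2) by (intro blinfun_eqI) auto
  qed
  then show ?thesis by (rule that)
qed

text \<open>Maximising \<open>q\<close> and then a separating sequence lexicographically singles out an extreme point.\<close>
lemma extreme_point_attains_max:
  fixes Q :: "('c::real_normed_vector) dual set"
  assumes sep: "separable_space (euclidean :: 'c topology)"
    and Q: "compactin weak_star Q" "Q \<noteq> {}"
  obtains v where "v extreme_point_of Q" "\<And>u. u \<in> Q \<Longrightarrow> blinfun_apply u q \<le> blinfun_apply v q"
proof -
  obtain P :: "nat \<Rightarrow> 'c"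
    where P: "\<And>u v :: 'c dual. (\<And>n. blinfun_apply u (P n) = blinfun_apply v (P n)) \<Longrightarrow> u = v"
    using separating_sequence[OF sep] by blast
  define top where "top p S = {u\<in>S. \<forall>w\<in>S. blinfun_apply w p \<le> blinfun_apply u p}"
    for p :: 'c and S :: "'c dual set"
  define S where "S = rec_nat (top q Q) (\<lambda>n. top (P n))"
  have S0: "S 0 = top q Q" and SS: "S (Suc n) = top (P n) (S n)" for n
    by (simp_all add: S_def)
  have top: "compactin weak_star (top p R) \<and> top p R \<noteq> {}" if R: "compactin weak_star R" "R \<noteq> {}" for p R
  proof -
    obtain u where u: "u \<in> R" "\<And>v. v \<in> R \<Longrightarrow> - blinfun_apply u p \<le> - blinfun_apply v p"
      using compactin_attains_inf[OF R(1) _ R(2), of "\<lambda>u. - blinfun_apply u p"]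
        continuous_map_eval by (metis continuous_map_minus)
    then have "top p R = {w. blinfun_apply u p \<le> blinfun_apply w p} \<inter> R"
      by (force simp: top_def)
    then show ?thesis using closed_Int_compactin[OF closedin_weak_star_ge R(1)] u by auto
  qed
  have S: "compactin weak_star (S n) \<and> S n \<noteq> {}" for n
    by (induction n) (use top Q in \<open>auto simp: S0 SS\<close>)
  have dec: "decseq S" by (rule decseq_SucI) (auto simp: SS top_def)
  have "Q \<inter> (\<Inter>n. S n) \<noteq> {}"
  proof (rule compactin_nest[OF Q(1)])
    have "S n \<subseteq> Q" for n
      using decseqD[OF dec, of 0 n] by (auto simp: S0 top_def)
    then show "Q \<inter> S n \<noteq> {}" for n using S by blast
  qed (use S dec compactin_weak_star_imp_closedin in auto)
  then obtain v where v: "v \<in> Q" "\<And>n. v \<in> S n" by blast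
  \<comment> \<open>A functional whose value inside an open segment is at least its values at both
    endpoints is constant there, so sets of maximisers are faces.\<close>
  have seg: "blinfun_apply a p = blinfun_apply w p \<and> blinfun_apply b p = blinfun_apply w p"
    if w: "w \<in> open_segment a b" and le: "blinfun_apply a p \<le> blinfun_apply w p"
      "blinfun_apply b p \<le> blinfun_apply w p" for a b w :: "'c dual" and p
  proof -
    obtain t where t: "0 < t" "t < 1" "w = (1 - t) *\<^sub>R a + t *\<^sub>R b"
      using w unfolding in_segment(2) by blast
    have "blinfun_apply w p = (1 - t) * blinfun_apply a p + t * blinfun_apply b p"
      unfolding t(3) by (simp add: blinfun.add_left blinfun.scaleR_left)
    then have "(1 - t) * (blinfun_apply w p - blinfun_apply a p) + t * (blinfun_apply w p - blinfun_apply b p) = 0"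
      by algebra
    moreover have "0 \<le> (1 - t) * (blinfun_apply w p - blinfun_apply a p)"
       "0 \<le> t * (blinfun_apply w p - blinfun_apply b p)" using t(1,2) le by simp_all
    ultimately have "(1 - t) * (blinfun_apply w p - blinfun_apply a p) = 0"
       "t * (blinfun_apply w p - blinfun_apply b p) = 0" by linarith+
    then show ?thesis using t(1,2) by simp
  qed
  \<comment> \<open>Both endpoints of a segment through \<open>v\<close> survive every stage of the
    selection, so they agree along all of \<open>P\<close>.\<close>
  have face: "a \<in> S n \<and> b \<in> S n" if ab: "a \<in> Q" "b \<in> Q" "v \<in> open_segment a b" for a b n
  proof (induction n)
    case 0
    then show ?case using v(2)[of 0] seg[OF ab(3), of q] ab by (auto simp: S0 top_def)
  next
    case (Suc n)
    then show ?case using v(2)[of "Suc n"] seg[OF ab(3), of "P n"] by (auto simp: SS top_def)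
  qed
  have "v extreme_point_of Q"
    unfolding extreme_point_of_def
  proof (intro conjI ballI notI)
    fix a b assume ab: "a \<in> Q" "b \<in> Q" "v \<in> open_segment a b"
    have "blinfun_apply a (P n) = blinfun_apply b (P n)" for n
      using face[OF ab, of n] v(2)[of "Suc n"] seg[OF ab(3), of "P n"] by (auto simp: SS top_def)
    then have "a = b" by (rule P)
    then show False using ab(3) by simp
  qed (fact v)
  moreover have "blinfun_apply u q \<le> blinfun_apply v q" if "u \<in> Q" for u
    using v(2)[of 0] that by (auto simp: S0 top_def)
  ultimately show ?thesis by (rule that)
qed

text \<open>Evaluation along a separating sequence embeds \<open>Q\<close> into the metrizable space
  of real sequences, where compactness yields convergent subsequences. Sequences matter because the
  strong continuity of \<open>K\<close> is assumed along them.\<close>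

lemma weak_star_seq_compact:
  fixes Q :: "('c::real_normed_vector) dual set"
  assumes sep: "separable_space (euclidean :: 'c topology)"
    and Q: "compactin weak_star Q" and U: "\<And>n::nat. U n \<in> Q"
  obtains r u where "strict_mono (r :: nat \<Rightarrow> nat)" "u \<in> Q" "limitin weak_star (U \<circ> r) u sequentially"
proof -
  obtain P :: "nat \<Rightarrow> 'c"
    where P: "\<And>u v :: 'c dual. (\<And>n. blinfun_apply u (P n) = blinfun_apply v (P n)) \<Longrightarrow> u = v"
    using separating_sequence[OF sep] by blast
  define e where "e u n = blinfun_apply u (P n)" for u :: "'c dual" and n
  have e: "continuous_map weak_star euclidean e"
    unfolding e_def euclidean_product_topology[symmetric] continuous_map_componentwise_UNIV
    by (simp add: continuous_map_eval)
  have inj: "inj e" using P by (intro injI) (metis e_def)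
  have "compact (e ` Q)" using image_compactin[OF Q e] by simp
  moreover have "\<And>n. (e \<circ> U) n \<in> e ` Q" using U by auto
  ultimately obtain l r where l: "l \<in> e ` Q" "strict_mono r" "((e \<circ> U) \<circ> r) \<longlonglongrightarrow> l"
    unfolding compact_def by blast
  \<comment> \<open>A continuous injection of a compact space into a Hausdorff space has a
    continuous inverse on its image.\<close>
  have inv: "continuous_map (top_of_set (e ` Q)) (subtopology weak_star Q) (inv e)"
    by (rule continuous_inverse_map)
      (use e Q inj in \<open>auto simp: compact_space_subtopology continuous_map_from_subtopology
         strong_operator_topology_topspace\<close>)
  have "limitin (top_of_set (e ` Q)) ((e \<circ> U) \<circ> r) l sequentially"
    using l U by (auto simp: limitin_subtopology)
  then have "limitin (subtopology weak_star Q) (inv e \<circ> ((e \<circ> U) \<circ> r)) (inv e l) sequentially"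
    by (rule continuous_map_limit[OF inv])
  moreover have "inv e \<circ> ((e \<circ> U) \<circ> r) = U \<circ> r" using inj by (auto simp: fun_eq_iff)
  ultimately have "limitin weak_star (U \<circ> r) (inv e l) sequentially" "inv e l \<in> Q"
    by (auto simp: limitin_subtopology)
  then show ?thesis using that l(2) by blast
qed

section \<open>Measures representing points of compact convex sets\<close>

lemma dominated_by_mono: "dominated_by X l \<Longrightarrow> X \<subseteq> Y \<Longrightarrow> dominated_by Y l"
  unfolding dominated_by_def by blast

lemma dominated_by_mem: "u \<in> X \<Longrightarrow> dominated_by X (blinfun_apply u)"
  unfolding dominated_by_def by blast

lemma linear_blinfun_apply: "linear (blinfun_apply u)"
  by (simp add: blinfun.bounded_linear_right bounded_linear.linear)

lemma closedin_dominated_by: "closedin weak_star {u. dominated_by X (blinfun_apply u)}"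
proof -
  have "{u. dominated_by X (blinfun_apply u)} =
      (\<Inter>(p, c) \<in> {(p, c). \<forall>x\<in>X. blinfun_apply x p \<le> c}. {u. blinfun_apply u p \<le> c})"
    by (auto simp: dominated_by_def)
  also have "closedin weak_star \<dots>"
  proof (rule closedin_Inter)
    show "(\<lambda>(p, c). {u. blinfun_apply u p \<le> c}) ` {(p, c). \<forall>x\<in>X. blinfun_apply x p \<le> c} \<noteq> {}"
    proof -
      have "(0, 0) \<in> {(p, c). \<forall>x\<in>X. blinfun_apply x p \<le> c}" by simp
      then show ?thesis by blast
    qed
  qed (auto simp: closedin_weak_star_le)
  finally show ?thesis .
qed

lemma convex_dominated_by: "convex {u. dominated_by X (blinfun_apply u)}"
  unfolding convex_def
proof (clarify)
  fix u v :: "'a dual" and a b :: real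
  assume u: "dominated_by X (blinfun_apply u)" and v: "dominated_by X (blinfun_apply v)"
    and ab: "0 \<le> a" "0 \<le> b" "a + b = 1"
  show "dominated_by X (blinfun_apply (a *\<^sub>R u + b *\<^sub>R v))"
    unfolding dominated_by_def
  proof (intro allI impI)
    fix p c assume "\<forall>x\<in>X. blinfun_apply x p \<le> c"
    then have "blinfun_apply u p \<le> c" "blinfun_apply v p \<le> c"
      using u v by (auto simp: dominated_by_def)
    then show "blinfun_apply (a *\<^sub>R u + b *\<^sub>R v) p \<le> c"
      using convex_bound_le[of "blinfun_apply u p" c "blinfun_apply v p" a b] ab
      by (simp add: blinfun.add_left blinfun.scaleR_left)
  qed
qed

lemma convex_combine:
  assumes "convex C" "a \<in> C" "b \<in> C" "0 \<le> x" "0 \<le> y"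
  obtains c where "c \<in> C" "x *\<^sub>R a + y *\<^sub>R b = (x + y) *\<^sub>R c"
proof (cases "x + y = 0")
  case True
  then have "x = 0" "y = 0" using assms by auto
  then show ?thesis using that assms(2) by simp
next
  case False
  then have "(x / (x + y)) *\<^sub>R a + (y / (x + y)) *\<^sub>R b \<in> C"
    using assms by (intro convexD) (auto simp: add_divide_distrib[symmetric])
  then show ?thesis by (rule that) (use False in \<open>simp add: scaleR_add_right\<close>)
qed

text \<open>A combination of two such points regroups into one part from \<open>C\<close> and one
  from \<open>D\<close>, each merged by \<open>convex_combine\<close>. Two-point combinations thus
  exhaust the convex hull of two nonempty convex sets.\<close>

lemma convex_join:
  assumes "convex C" "convex D"
  shows "convex {t *\<^sub>R a + s *\<^sub>R b |t s a b. 0 \<le> t \<and> 0 \<le> s \<and> t + s = 1 \<and> a \<in> C \<and> b \<in> D}"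
proof (rule convexI, clarify)
  fix x y t s t' s' :: real and a b a' b'
  assume h: "0 \<le> x" "0 \<le> y" "x + y = 1" "0 \<le> t" "0 \<le> s" "t + s = 1" "a \<in> C" "b \<in> D"
    "0 \<le> t'" "0 \<le> s'" "t' + s' = 1" "a' \<in> C" "b' \<in> D"
  obtain c where c: "c \<in> C" "(x * t) *\<^sub>R a + (y * t') *\<^sub>R a' = (x * t + y * t') *\<^sub>R c"
    using convex_combine[OF assms(1) h(7,12), of "x * t" "y * t'"] h by auto
  obtain d where d: "d \<in> D" "(x * s) *\<^sub>R b + (y * s') *\<^sub>R b' = (x * s + y * s') *\<^sub>R d"
    using convex_combine[OF assms(2) h(8,13), of "x * s" "y * s'"] h by auto
  have "x *\<^sub>R (t *\<^sub>R a + s *\<^sub>R b) + y *\<^sub>R (t' *\<^sub>R a' + s' *\<^sub>R b') =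
      ((x * t) *\<^sub>R a + (y * t') *\<^sub>R a') + ((x * s) *\<^sub>R b + (y * s') *\<^sub>R b')"
    by (simp add: scaleR_add_right)
  also have "\<dots> = (x * t + y * t') *\<^sub>R c + (x * s + y * s') *\<^sub>R d" by (simp only: c d)
  finally have eq: "x *\<^sub>R (t *\<^sub>R a + s *\<^sub>R b) + y *\<^sub>R (t' *\<^sub>R a' + s' *\<^sub>R b') =
     (x * t + y * t') *\<^sub>R c + (x * s + y * s') *\<^sub>R d" .
  have "(x * t + y * t') + (x * s + y * s') = x * (t + s) + y * (t' + s')"
    by (simp only: distrib_left ac_simps)
  then have "(x * t + y * t') + (x * s + y * s') = 1" by (simp only: h mult_1_right)
  moreover have "0 \<le> x * t + y * t'" "0 \<le> x * s + y * s'" using h by simp_all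
  ultimately show "\<exists>ta sa aa ba. x *\<^sub>R (t *\<^sub>R a + s *\<^sub>R b) + y *\<^sub>R (t' *\<^sub>R a' + s' *\<^sub>R b') =
      ta *\<^sub>R aa + sa *\<^sub>R ba \<and> 0 \<le> ta \<and> 0 \<le> sa \<and> ta + sa = 1 \<and> aa \<in> C \<and> ba \<in> D"
    using c(1) d(1)
    by (intro exI[of _ "x * t + y * t'"] exI[of _ "x * s + y * s'"] exI[of _ c] exI[of _ d] conjI eq)
qed

text \<open>The join \<open>R\<close> of the hulls \<open>H X1\<close> and \<open>H X2\<close> is
  convex, and compact as a continuous image of \<open>{0..1} \<times> H X1 \<times> H X2\<close>. It
  contains both sets, so \<open>u\<close> is dominated by \<open>R\<close> and
  \<open>dominated_by_represented\<close> puts it into \<open>R\<close>. The pieces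
  \<open>Y1\<close>, \<open>Y2\<close> range over \<open>{X1, X2}\<close> so that an empty set can
  be replaced by the other one.\<close>

lemma dominated_by_Un_split:
  assumes Q: "compactin weak_star Q" "convex Q" and X: "X1 \<subseteq> Q" "X2 \<subseteq> Q"
    and u: "u \<in> Q" "dominated_by (X1 \<union> X2) (blinfun_apply u)"
  shows "\<exists>t Y1 Y2 u1 u2. 0 \<le> t \<and> t \<le> 1 \<and> Y1 \<in> {X1, X2} \<and> Y2 \<in> {X1, X2} \<and>
    u1 \<in> Q \<and> dominated_by Y1 (blinfun_apply u1) \<and> u2 \<in> Q \<and> dominated_by Y2 (blinfun_apply u2) \<and>
    u = t *\<^sub>R u1 + (1 - t) *\<^sub>R u2"
proof (cases "X1 = {} \<or> X2 = {}")
  case True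
  then obtain Y where "Y \<in> {X1, X2}" "dominated_by Y (blinfun_apply u)"
    using u(2) by (metis Un_empty_left Un_empty_right insertI1 insertI2)
  then show ?thesis using u(1)
    by (intro exI[of _ "0::real"] exI[of _ Y] exI[of _ u] conjI) simp_all
next
  case False
  define H where "H Y = Q \<inter> {u. dominated_by Y (blinfun_apply u)}" for Y :: "'a dual set"
  have H: "compactin weak_star (H Y)" "convex (H Y)" for Y
    unfolding H_def using Q closedin_dominated_by convex_dominated_by
    by (auto intro: compact_Int_closedin convex_Int)
  have XH: "X1 \<subseteq> H X1" "X2 \<subseteq> H X2" using X by (auto simp: H_def dominated_by_mem)
  define R where
    "R = {t *\<^sub>R a + s *\<^sub>R b |t s a b. 0 \<le> t \<and> 0 \<le> s \<and> t + s = 1 \<and> a \<in> H X1 \<and> b \<in> H X2}"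
  let ?T = "prod_topology euclideanreal (prod_topology weak_star weak_star)"
  define h where "h = (\<lambda>(t::real, a :: 'a dual, b :: 'a dual). t *\<^sub>R a + (1 - t) *\<^sub>R b)"
  have "R = h ` ({0..1} \<times> H X1 \<times> H X2)"
  proof (intro equalityI subsetI)
    fix x assume "x \<in> R"
    then obtain t s a b where "0 \<le> t" "0 \<le> s" "t + s = 1" "a \<in> H X1" "b \<in> H X2" "x = t *\<^sub>R a + s *\<^sub>R b"
      unfolding R_def by blast
    then have "x = h (t, a, b)" "(t, a, b) \<in> {0..1} \<times> H X1 \<times> H X2"
      by (auto simp: h_def eq_diff_eq' add.commute)
    then show "x \<in> h ` ({0..1} \<times> H X1 \<times> H X2)" by blast
  next
    fix x assume "x \<in> h ` ({0..1} \<times> H X1 \<times> H X2)"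
    then obtain t a b where "0 \<le> t" "t \<le> 1" "a \<in> H X1" "b \<in> H X2" "x = t *\<^sub>R a + (1 - t) *\<^sub>R b"
      by (auto simp: h_def)
    moreover from this have "0 \<le> 1 - t" "t + (1 - t) = 1" by auto
    ultimately show "x \<in> R" unfolding R_def by blast
  qed
  moreover have "compactin weak_star (h ` ({0..1} \<times> H X1 \<times> H X2))"
  proof (rule image_compactin[where X = ?T])
    show "compactin ?T ({0..1} \<times> H X1 \<times> H X2)"
      by (simp add: compactin_Times H)
    have t: "continuous_map ?T euclideanreal fst"
      by (rule continuous_map_fst)
    have a: "continuous_map ?T weak_star (\<lambda>x. fst (snd x))" and b: "continuous_map ?T weak_star (\<lambda>x. snd (snd x))"
      using continuous_map_fst_of[OF continuous_map_snd] continuous_map_snd_of[OF continuous_map_snd]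
      by (auto simp: o_def)
    have ev: "continuous_map ?T euclideanreal (\<lambda>x. blinfun_apply (fst (snd x)) p)"
       "continuous_map ?T euclideanreal (\<lambda>x. blinfun_apply (snd (snd x)) p)" for p
      using continuous_map_compose[OF a continuous_map_eval[of p]]
        continuous_map_compose[OF b continuous_map_eval[of p]] by (auto simp: o_def)
    show "continuous_map ?T weak_star h"
      unfolding continuous_on_strong_operator_topo_iff_coordinatewise
      by (auto simp: h_def case_prod_beta blinfun.add_left blinfun.scaleR_left
          intro!: continuous_map_add continuous_map_real_mult continuous_map_diff t ev
            continuous_map_canonical_const)
  qed
  ultimately have "compactin weak_star R" by simp
  moreover have "convex R" unfolding R_def by (rule convex_join[OF H(2) H(2)])
  moreover have "X1 \<union> X2 \<subseteq> R"
  proof -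
    obtain x1 x2 where x: "x1 \<in> X1" "x2 \<in> X2" using False by blast
    have "x \<in> R" if "x \<in> X1" for x
      unfolding R_def mem_Collect_eq using that x XH
      by (intro exI[of _ "1::real"] exI[of _ "0::real"] exI[of _ x] exI[of _ x2]) auto
    moreover have "x \<in> R" if "x \<in> X2" for x
      unfolding R_def mem_Collect_eq using that x XH
      by (intro exI[of _ "0::real"] exI[of _ "1::real"] exI[of _ x1] exI[of _ x]) auto
    ultimately show ?thesis by blast
  qed
  then have "dominated_by R (blinfun_apply u)" using u(2) dominated_by_mono by blast
  ultimately have "u \<in> R"
    using dominated_by_represented[of R, OF _ _ linear_blinfun_apply]
    by (metis blinfun_eqI)
  then obtain t s a b where "0 \<le> t" "0 \<le> s" "t + s = 1" "a \<in> H X1" "b \<in> H X2" "u = t *\<^sub>R a + s *\<^sub>R b"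
    unfolding R_def by blast
  moreover from this have "s = 1 - t" by simp
  ultimately show ?thesis unfolding H_def
    by (intro exI[of _ t] exI[of _ X1] exI[of _ X2] exI[of _ a] exI[of _ b]) auto
qed

section \<open>Weak* Borel sets and random walks\<close>

abbreviation weak_star_borel :: "('c::real_normed_vector) dual set \<Rightarrow> 'c dual measure" where
  "weak_star_borel X \<equiv> sigma X {U. openin (subtopology weak_star X) U}"

lemma openin_weak_star_subset: "{U. openin (subtopology weak_star X) U} \<subseteq> Pow X"
  using openin_subset topspace_subtopology_subset by fastforce

lemma space_weak_star_borel: "space (weak_star_borel X) = X"
  by (simp add: openin_weak_star_subset)

lemma eval_measurable: "(\<lambda>v. blinfun_apply v p) \<in> borel_measurable (weak_star_borel X)"
proof (rule borel_measurableI)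
  fix S :: "real set" assume "open S"
  then have "openin weak_star {v. blinfun_apply v p \<in> S}"
    using openin_continuous_map_preimage[OF continuous_map_eval[of p], of S]
    by (simp add: strong_operator_topology_topspace)
  then have "openin (subtopology weak_star X) ((\<lambda>v. blinfun_apply v p) -` S \<inter> X)"
    by (auto simp: openin_subtopology)
  then show "(\<lambda>v. blinfun_apply v p) -` S \<inter> space (weak_star_borel X) \<in> sets (weak_star_borel X)"
    unfolding space_weak_star_borel by (simp add: openin_weak_star_subset)
qed

text \<open>The state \<open>s\<close> at time \<open>n\<close> moves to \<open>L n s\<close> with probability \<open>q n s\<close> and to \<open>R n s\<close>
  otherwise, driven by a stream of uniform variables; \<open>m\<close> counts the steps.\<close>
primrec walk :: "(nat \<Rightarrow> 's \<Rightarrow> real) \<Rightarrow> (nat \<Rightarrow> 's \<Rightarrow> 's) \<Rightarrow> (nat \<Rightarrow> 's \<Rightarrow> 's) \<Rightarrow>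
    nat \<Rightarrow> nat \<Rightarrow> 's \<Rightarrow> real stream \<Rightarrow> 's" where
  "walk q L R 0 n s \<omega> = s"
| "walk q L R (Suc m) n s \<omega> =
    walk q L R m (Suc n) (if shd \<omega> < q n s then L n s else R n s) (stl \<omega>)"

text \<open>Comparing a uniform variable with \<open>q\<close> realises a coin of any bias, so one
  driving stream serves all state-dependent probabilities.\<close>

definition unit_uniform :: "real measure" where
  "unit_uniform = uniform_measure lborel {0..1}"

lemma sets_unit_uniform [measurable_cong]: "sets unit_uniform = sets borel"
  by (simp add: unit_uniform_def)

lemma prob_space_unit_uniform: "prob_space unit_uniform"
  unfolding unit_uniform_def by (rule prob_space_uniform_measure) simp_all

lemma unit_uniform_split:
  assumes "0 \<le> q" "q \<le> 1" "0 \<le> a" "0 \<le> b"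
  shows "(\<integral>\<^sup>+x. (if x < q then ennreal a else ennreal b) \<partial>unit_uniform) = ennreal (q * a + (1 - q) * b)"
proof -
  have "{0..1} \<inter> {..<q} = {0..<q}" "{0..1} \<inter> {q..} = {q..1}" using assms by auto
  then have e: "emeasure unit_uniform {..<q} = ennreal q" "emeasure unit_uniform {q..} = ennreal (1 - q)"
    using assms by (simp_all add: unit_uniform_def divide_ennreal_def)
  have "(\<integral>\<^sup>+x. (if x < q then ennreal a else ennreal b) \<partial>unit_uniform) =
      (\<integral>\<^sup>+x. ennreal a * indicator {..<q} x + ennreal b * indicator {q..} x \<partial>unit_uniform)"
    by (intro nn_integral_cong) (auto simp: indicator_def)
  also have "\<dots> = ennreal a * emeasure unit_uniform {..<q} + ennreal b * emeasure unit_uniform {q..}"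
    by (subst nn_integral_add) (auto simp: nn_integral_cmult_indicator)
  also have "\<dots> = ennreal (q * a + (1 - q) * b)"
    unfolding e using assms by (simp add: ennreal_mult[symmetric] ennreal_plus[symmetric] mult.commute
        del: ennreal_plus)
  finally show ?thesis .
qed

text \<open>After \<open>m\<close> steps only finitely many states are reachable, so even the
  discrete sigma-algebra on states is admissible. Every condition on the current state is then an
  event.\<close>

lemma walk_measurable:
  "walk q L R m n s \<in> measurable (stream_space unit_uniform) (count_space UNIV)"
proof (induction m arbitrary: n s)
  case 0
  have "walk q L R 0 n s = (\<lambda>_. s)" by (simp add: fun_eq_iff)
  then show ?case by simp
next
  case (Suc m)
  have [measurable]: "shd \<in> borel_measurable (stream_space unit_uniform)"
    using measurable_shd[of unit_uniform] by (simp add: measurable_cong_sets[OF refl sets_unit_uniform])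
  have "(\<lambda>\<omega>. if shd \<omega> < q n s then walk q L R m (Suc n) (L n s) (stl \<omega>)
      else walk q L R m (Suc n) (R n s) (stl \<omega>)) \<in> measurable (stream_space unit_uniform) (count_space UNIV)"
    by (intro measurable_If measurable_compose[OF measurable_stl Suc.IH]) measurable
  then show ?case by (simp add: if_distrib if_distribR cong: if_cong)
qed

text \<open>\<open>walk\<close> recurses on the first step, whereas invariants along a path compare
  consecutive times; this exposes the last step.\<close>

lemma walk_step:
  "walk q L R (Suc m) n s \<omega> = L (n + m) (walk q L R m n s \<omega>) \<or>
   walk q L R (Suc m) n s \<omega> = R (n + m) (walk q L R m n s \<omega>)"
  by (induction m arbitrary: n s \<omega>) (simp, metis add_Suc_shift walk.simps(2))

text \<open>The martingale property: \<open>g\<close> averages its values at the two successors of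
  any state in the invariant \<open>V\<close>, so integrating out the head of the stream preserves
  the expectation.\<close>

lemma nn_integral_walk:
  assumes V: "V s"
    and step: "\<And>n s. V s \<Longrightarrow> V (L n s) \<and> V (R n s) \<and> 0 \<le> q n s \<and> q n s \<le> 1 \<and>
      g s = q n s * g (L n s) + (1 - q n s) * g (R n s)"
    and pos: "\<And>s. V s \<Longrightarrow> 0 \<le> g s"
  shows "(\<integral>\<^sup>+\<omega>. ennreal (g (walk q L R m n s \<omega>)) \<partial>stream_space unit_uniform) = ennreal (g s)"
  using V
proof (induction m arbitrary: n s)
  case 0
  interpret prob_space "stream_space unit_uniform"
    by (rule prob_space.prob_space_stream_space[OF prob_space_unit_uniform])
  show ?case by (simp add: emeasure_space_1)
next
  case (Suc m)
  note st = step[OF Suc.prems, of n]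
  have "(\<integral>\<^sup>+\<omega>. ennreal (g (walk q L R (Suc m) n s \<omega>)) \<partial>stream_space unit_uniform) =
     (\<integral>\<^sup>+x. (\<integral>\<^sup>+\<omega>. ennreal (g (walk q L R (Suc m) n s (x ## \<omega>))) \<partial>stream_space unit_uniform) \<partial>unit_uniform)"
    by (rule prob_space.nn_integral_stream_space[OF prob_space_unit_uniform])
      (rule measurable_compose[OF walk_measurable], simp)
  also have "\<dots> = (\<integral>\<^sup>+x. (if x < q n s then ennreal (g (L n s)) else ennreal (g (R n s))) \<partial>unit_uniform)"
    using st by (intro nn_integral_cong) (simp add: Suc.IH)
  also have "\<dots> = ennreal (q n s * g (L n s) + (1 - q n s) * g (R n s))"
    using st pos by (intro unit_uniform_split) auto
  finally show ?case using st by simp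
qed

text \<open>Both halfspaces contain the level \<open>r\<close>, so the two parts of \<open>Y\<close>
  are closed and cover it. Either child may receive either part, whence the disjunctions.\<close>

lemma halfspace_split:
  assumes Q: "compactin weak_star Q" "convex Q" and X: "X \<subseteq> Q"
    and Y: "closedin weak_star Y" "Y \<subseteq> X" and v: "v \<in> Q" "dominated_by Y (blinfun_apply v)"
  obtains t Y1 v1 Y2 v2 where "0 \<le> t" "t \<le> 1" "v = t *\<^sub>R v1 + (1 - t) *\<^sub>R v2"
    "closedin weak_star Y1" "Y1 \<subseteq> Y" "v1 \<in> Q" "dominated_by Y1 (blinfun_apply v1)"
    "closedin weak_star Y2" "Y2 \<subseteq> Y" "v2 \<in> Q" "dominated_by Y2 (blinfun_apply v2)"
    "(\<forall>y\<in>Y1. blinfun_apply y p \<le> r) \<or> (\<forall>y\<in>Y1. r \<le> blinfun_apply y p)"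
    "(\<forall>y\<in>Y2. blinfun_apply y p \<le> r) \<or> (\<forall>y\<in>Y2. r \<le> blinfun_apply y p)"
proof -
  define Z1 where "Z1 = Y \<inter> {y. blinfun_apply y p \<le> r}"
  define Z2 where "Z2 = Y \<inter> {y. r \<le> blinfun_apply y p}"
  have cl: "closedin weak_star Z1" "closedin weak_star Z2"
    unfolding Z1_def Z2_def by (auto intro: closedin_Int Y closedin_weak_star_le closedin_weak_star_ge)
  have "Z1 \<union> Z2 = Y" by (auto simp: Z1_def Z2_def)
  then have "dominated_by (Z1 \<union> Z2) (blinfun_apply v)" using v by simp
  moreover have "Z1 \<subseteq> Q" "Z2 \<subseteq> Q" using X Y by (auto simp: Z1_def Z2_def)
  ultimately obtain t Y1 Y2 v1 v2 where h: "0 \<le> t" "t \<le> 1" "Y1 \<in> {Z1, Z2}" "Y2 \<in> {Z1, Z2}"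
    "v1 \<in> Q" "dominated_by Y1 (blinfun_apply v1)" "v2 \<in> Q" "dominated_by Y2 (blinfun_apply v2)"
    "v = t *\<^sub>R v1 + (1 - t) *\<^sub>R v2"
    using dominated_by_Un_split[OF Q _ _ v(1)] by metis
  have "closedin weak_star Z \<and> Z \<subseteq> Y \<and>
      ((\<forall>y\<in>Z. blinfun_apply y p \<le> r) \<or> (\<forall>y\<in>Z. r \<le> blinfun_apply y p))"
    if "Z \<in> {Z1, Z2}" for Z
    using that cl by (auto simp: Z1_def Z2_def)
  note Z = this[OF h(3)] this[OF h(4)]
  show ?thesis
    using that[OF h(1,2,9) _ _ h(5,6) _ _ h(7,8)] Z by simp
qed

text \<open>Choquet representation. Split \<open>u\<close> along the halfspaces given by a separating sequence and
  rational levels, always into points dominated by the two halves of the current piece of \<open>X\<close>.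
  The pieces along a random path shrink to a single point of \<open>X\<close>, and the expectation of the
  current point is \<open>u\<close> at every step.\<close>
lemma barycenter_measure:
  fixes Q :: "('c::real_normed_vector) dual set"
  assumes sep: "separable_space (euclidean :: 'c topology)"
    and Q: "compactin weak_star Q" "convex Q" and X: "closedin weak_star X" "X \<subseteq> Q"
    and u: "u \<in> Q" "dominated_by X (blinfun_apply u)"
  obtains \<mu> where "sets \<mu> = sets (weak_star_borel X)" "prob_space \<mu>"
    "\<And>p. blinfun_apply u p = (\<integral>v. blinfun_apply v p \<partial>\<mu>)"
proof -
  obtain P :: "nat \<Rightarrow> 'c"
    where P: "\<And>u v :: 'c dual. (\<And>n. blinfun_apply u (P n) = blinfun_apply v (P n)) \<Longrightarrow> u = v"
    using separating_sequence[OF sep] by blast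
  \<comment> \<open>Every pair of an index into \<open>P\<close> and a rational level comes up at
    some time.\<close>
  define en :: "nat \<Rightarrow> nat \<times> rat" where "en = from_nat"
  define fp where "fp n = P (fst (en n))" for n
  define fr where "fr n = (of_rat (snd (en n)) :: real)" for n
  \<comment> \<open>A state pairs a closed piece of \<open>X\<close> with a point in its closed
    convex hull.\<close>
  define V where "V S \<longleftrightarrow> closedin weak_star (fst S) \<and> fst S \<subseteq> X \<and> snd S \<in> Q \<and>
    dominated_by (fst S) (blinfun_apply (snd S))" for S :: "'c dual set \<times> 'c dual"
  define child where "child n S S' \<longleftrightarrow> V S' \<and> fst S' \<subseteq> fst S \<and>
      ((\<forall>y\<in>fst S'. blinfun_apply y (fp n) \<le> fr n) \<or> (\<forall>y\<in>fst S'. fr n \<le> blinfun_apply y (fp n)))"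
    for n and S S' :: "'c dual set \<times> 'c dual"
  have "\<exists>t S1 S2. V S \<longrightarrow> 0 \<le> t \<and> t \<le> 1 \<and> snd S = t *\<^sub>R snd S1 + (1 - t) *\<^sub>R snd S2 \<and>
     child n S S1 \<and> child n S S2" for n S
  proof (cases "V S")
    case True
    then obtain t Y1 v1 Y2 v2 where "0 \<le> t" "t \<le> 1" "snd S = t *\<^sub>R v1 + (1 - t) *\<^sub>R v2"
      "closedin weak_star Y1" "Y1 \<subseteq> fst S" "v1 \<in> Q" "dominated_by Y1 (blinfun_apply v1)"
      "closedin weak_star Y2" "Y2 \<subseteq> fst S" "v2 \<in> Q" "dominated_by Y2 (blinfun_apply v2)"
      "(\<forall>y\<in>Y1. blinfun_apply y (fp n) \<le> fr n) \<or> (\<forall>y\<in>Y1. fr n \<le> blinfun_apply y (fp n))"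
      "(\<forall>y\<in>Y2. blinfun_apply y (fp n) \<le> fr n) \<or> (\<forall>y\<in>Y2. fr n \<le> blinfun_apply y (fp n))"
      unfolding V_def by (elim conjE) (rule halfspace_split[OF Q X(2), of "fst S" "snd S" "fp n" "fr n"])
    with True show ?thesis
      by (intro exI[of _ t] exI[of _ "(Y1, v1)"] exI[of _ "(Y2, v2)"])
        (simp add: child_def V_def subset_trans[of _ "fst S" X])
  qed simp
  then have "\<forall>n S. \<exists>t S1 S2. V S \<longrightarrow> 0 \<le> t \<and> t \<le> 1 \<and>
      snd S = t *\<^sub>R snd S1 + (1 - t) *\<^sub>R snd S2 \<and> child n S S1 \<and> child n S S2"
    by blast
  then obtain q L R where "\<forall>n S. V S \<longrightarrow> 0 \<le> q n S \<and> q n S \<le> 1 \<and>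
      snd S = q n S *\<^sub>R snd (L n S) + (1 - q n S) *\<^sub>R snd (R n S) \<and> child n S (L n S) \<and> child n S (R n S)"
    unfolding choice_iff by blast
  then have st: "\<And>n S. V S \<Longrightarrow> 0 \<le> q n S \<and> q n S \<le> 1 \<and>
      snd S = q n S *\<^sub>R snd (L n S) + (1 - q n S) *\<^sub>R snd (R n S) \<and> child n S (L n S) \<and> child n S (R n S)"
    by blast
  define W where "W m = walk q L R m 0 (X, u)" for m
  have V0: "V (X, u)" using X u by (simp add: V_def)
  have VW: "V (W m \<omega>)" for m \<omega>
  proof (induction m)
    case 0 then show ?case using V0 by (simp add: W_def)
  next
    case (Suc m)
    then show ?case using walk_step[of q L R m 0 "(X, u)" \<omega>] st[of "W m \<omega>" m]
      unfolding W_def child_def by auto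
  qed
  have ch: "child m (W m \<omega>) (W (Suc m) \<omega>)" for m \<omega>
    using walk_step[of q L R m 0 "(X, u)" \<omega>] st[OF VW, of m m \<omega>] unfolding W_def by auto
  have dec: "decseq (\<lambda>m. fst (W m \<omega>))" for \<omega>
    by (rule decseq_SucI) (use ch in \<open>auto simp: child_def\<close>)
  have WX: "fst (W m \<omega>) \<subseteq> Q" and Wcl: "closedin weak_star (fst (W m \<omega>))" and Wne: "fst (W m \<omega>) \<noteq> {}"
    for m \<omega>
    using VW[of m \<omega>] X(2) dominated_by_nonempty[OF _ linear_blinfun_apply] by (auto simp: V_def)
  \<comment> \<open>Compactness: if every piece along a path meets a closed set \<open>C\<close>,
    the pieces have a common point in \<open>C\<close>.\<close>
  have nest: "\<exists>x\<in>C. \<forall>m. x \<in> fst (W m \<omega>)"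
    if C: "closedin weak_star C" "\<And>m. fst (W m \<omega>) \<inter> C \<noteq> {}" for C \<omega>
  proof -
    have "Q \<inter> (\<Inter>m. fst (W m \<omega>) \<inter> C) \<noteq> {}"
    proof (rule compactin_nest[OF Q(1)])
      show "Q \<inter> (fst (W m \<omega>) \<inter> C) \<noteq> {}" for m using C(2)[of m] WX[of m \<omega>] by blast
      show "decseq (\<lambda>m. fst (W m \<omega>) \<inter> C)" using dec[of \<omega>] unfolding decseq_def by blast
    qed (use Wcl C in auto)
    then show ?thesis by blast
  qed
  \<comment> \<open>The choice is harmless: \<open>uniq\<close> below shows that the common point is
    unique.\<close>
  define f where "f \<omega> = (SOME x. \<forall>m. x \<in> fst (W m \<omega>))" for \<omega>
  have f: "f \<omega> \<in> fst (W m \<omega>)" for \<omega> m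
  proof -
    have "closedin weak_star (UNIV :: 'c dual set)"
      using closedin_topspace[of weak_star] by (simp add: strong_operator_topology_topspace)
    then have "\<exists>x. \<forall>m. x \<in> fst (W m \<omega>)" using nest[of UNIV \<omega>] Wne by simp
    then show ?thesis unfolding f_def by (rule someI2_ex) blast
  qed
  have fX: "f \<omega> \<in> X" for \<omega> using f[of \<omega> 0] by (simp add: W_def)
  have uniq: "x = y" if x: "\<And>m. x \<in> fst (W m \<omega>)" and y: "\<And>m. y \<in> fst (W m \<omega>)" for x y \<omega>
  proof (rule ccontr)
    assume "x \<noteq> y"
    have *: False if x: "\<And>m. x \<in> fst (W m \<omega>)" and y: "\<And>m. y \<in> fst (W m \<omega>)"
      and less: "blinfun_apply x (P i) < blinfun_apply y (P i)" for x y i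
    proof -
      obtain r where r: "blinfun_apply x (P i) < of_rat r" "of_rat r < blinfun_apply y (P i)"
        using of_rat_dense[OF less] by blast
      \<comment> \<open>At this time the piece is cut at a level strictly between the two values, so
        at time \<open>Suc n\<close> it can no longer contain both points.\<close>
      define n where "n = to_nat (i, r)"
      have "fp n = P i" "fr n = of_rat r" by (simp_all add: n_def fp_def fr_def en_def)
      then show False using ch[of n \<omega>] x[of "Suc n"] y[of "Suc n"] r unfolding child_def by force
    qed
    obtain i where "blinfun_apply x (P i) \<noteq> blinfun_apply y (P i)" using P \<open>x \<noteq> y\<close> by blast
    then show False using *[OF x y] *[OF y x] by (meson linorder_neqE_linordered_idom)
  qed
  \<comment> \<open>Some piece misses the halfspace above \<open>f \<omega>\<close> by
    \<open>e\<close>, for otherwise \<open>nest\<close> and \<open>uniq\<close> would place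
    \<open>f \<omega>\<close> in it. Domination passes the bound on to the current point; applied to
    \<open>- p\<close> it becomes a lower bound.\<close>
  have upper: "\<exists>m. \<forall>n\<ge>m. blinfun_apply (snd (W n \<omega>)) p \<le> blinfun_apply (f \<omega>) p + e"
    if e: "e > 0" for e p \<omega>
  proof -
    have "\<exists>m. fst (W m \<omega>) \<inter> {y. blinfun_apply (f \<omega>) p + e \<le> blinfun_apply y p} = {}"
    proof (rule ccontr)
      assume "\<not> ?thesis"
      then obtain x where "blinfun_apply (f \<omega>) p + e \<le> blinfun_apply x p" "\<And>m. x \<in> fst (W m \<omega>)"
        using nest[OF closedin_weak_star_ge] by (metis mem_Collect_eq)
      with uniq[OF _ f] e show False by force
    qed
    then obtain m where m: "fst (W m \<omega>) \<inter> {y. blinfun_apply (f \<omega>) p + e \<le> blinfun_apply y p} = {}" ..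
    have "blinfun_apply (snd (W n \<omega>)) p \<le> blinfun_apply (f \<omega>) p + e" if "n \<ge> m" for n
    proof (rule dominated_byD[where X = "fst (W n \<omega>)" and l = "blinfun_apply (snd (W n \<omega>))" and p = p])
      show "dominated_by (fst (W n \<omega>)) (blinfun_apply (snd (W n \<omega>)))" using VW by (simp add: V_def)
      show "blinfun_apply x p \<le> blinfun_apply (f \<omega>) p + e" if "x \<in> fst (W n \<omega>)" for x
        using that m decseqD[OF dec \<open>n \<ge> m\<close>, of \<omega>] by force
    qed
    then show ?thesis by blast
  qed
  have conv: "(\<lambda>m. blinfun_apply (snd (W m \<omega>)) p) \<longlonglongrightarrow> blinfun_apply (f \<omega>) p" for \<omega> p
  proof (rule LIMSEQ_I)
    fix e :: real assume "e > 0"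
    then have e: "e / 2 > 0" by simp
    obtain m where m: "\<And>n. n \<ge> m \<Longrightarrow> blinfun_apply (snd (W n \<omega>)) p \<le> blinfun_apply (f \<omega>) p + e / 2"
      using upper[OF e] by blast
    obtain m' where m': "\<And>n. n \<ge> m' \<Longrightarrow> blinfun_apply (f \<omega>) p - e / 2 \<le> blinfun_apply (snd (W n \<omega>)) p"
      using upper[OF e, of \<omega> "- p"] unfolding blinfun.minus_right by (force simp: field_simps)
    have "norm (blinfun_apply (snd (W n \<omega>)) p - blinfun_apply (f \<omega>) p) < e" if "n \<ge> max m m'" for n
      using m[of n] m'[of n] that \<open>e > 0\<close> unfolding real_norm_def abs_less_iff by auto
    then show "\<exists>no. \<forall>n\<ge>no. norm (blinfun_apply (snd (W n \<omega>)) p - blinfun_apply (f \<omega>) p) < e" by blast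
  qed
  let ?S = "stream_space unit_uniform"
  interpret S: prob_space ?S
    by (rule prob_space.prob_space_stream_space[OF prob_space_unit_uniform])
  have spS: "space ?S = UNIV"
    by (simp add: space_stream_space unit_uniform_def streams_UNIV)
  have Wm: "W m \<in> measurable ?S (count_space UNIV)" for m
    unfolding W_def by (rule walk_measurable)
  have fm: "f \<in> measurable ?S (weak_star_borel X)"
  proof (rule measurable_measure_of[OF openin_weak_star_subset])
    fix U assume "U \<in> {U. openin (subtopology weak_star X) U}"
    then have U: "openin (subtopology weak_star X) U" by simp
    \<comment> \<open>By \<open>nest\<close> and \<open>uniq\<close>, \<open>f \<omega>\<close> lies
      in \<open>U\<close> exactly when some piece misses \<open>C\<close>: a countable union of
      events of the discrete walk.\<close>
    define C where "C = X - U"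
    have C: "closedin weak_star C" unfolding C_def
      using U X(1) by (metis closedin_closed_subtopology closedin_diff closedin_subset
          closedin_topspace topspace_subtopology_subset)
    have "f -` U \<inter> space ?S = (\<Union>m. W m -` {S. fst S \<inter> C = {}} \<inter> space ?S)"
    proof (intro equalityI subsetI)
      fix \<omega> assume "\<omega> \<in> f -` U \<inter> space ?S"
      then have "f \<omega> \<notin> C" by (simp add: C_def)
      then have "\<exists>m. fst (W m \<omega>) \<inter> C = {}" using nest[OF C, of \<omega>] uniq[OF _ f, of _ \<omega>] by metis
      then show "\<omega> \<in> (\<Union>m. W m -` {S. fst S \<inter> C = {}} \<inter> space ?S)" by (simp add: spS)
    next
      fix \<omega> assume "\<omega> \<in> (\<Union>m. W m -` {S. fst S \<inter> C = {}} \<inter> space ?S)"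
      then obtain m where "fst (W m \<omega>) \<inter> C = {}" by auto
      then have "f \<omega> \<notin> C" using f[of \<omega> m] by blast
      then show "\<omega> \<in> f -` U \<inter> space ?S" using fX[of \<omega>] by (simp add: C_def spS)
    qed
    also have "\<dots> \<in> sets ?S"
      by (intro sets.countable_UN image_subsetI measurable_sets[OF Wm]) simp
    finally show "f -` U \<inter> space ?S \<in> sets ?S" .
  qed (use fX in auto)
  have int: "(\<integral>\<omega>. blinfun_apply (f \<omega>) p \<partial>?S) = blinfun_apply u p" for p
  proof -
    obtain M where M: "\<And>w. w \<in> Q \<Longrightarrow> \<bar>blinfun_apply w p\<bar> \<le> M"
      using compactin_eval_bounded[OF Q(1)] by blast
    have snd_m: "(\<lambda>\<omega>. blinfun_apply (snd (W m \<omega>)) p) \<in> borel_measurable ?S" for m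
      by (rule measurable_compose[OF Wm]) simp
    have bd: "\<bar>blinfun_apply (snd (W m \<omega>)) p\<bar> \<le> M" for m \<omega>
      using VW[of m \<omega>] by (simp add: V_def M)
    have intW: "integrable ?S (\<lambda>\<omega>. blinfun_apply (snd (W m \<omega>)) p)" for m
      by (rule S.integrable_const_bound[of _ M]) (use bd snd_m in auto)
    have "(\<integral>\<omega>. blinfun_apply (snd (W m \<omega>)) p \<partial>?S) = blinfun_apply u p" for m
    proof -
      \<comment> \<open>\<open>M\<close> bounds the evaluation on \<open>Q\<close>, so the shift
        makes \<open>g\<close> nonnegative as \<open>nn_integral_walk\<close> demands.\<close>
      define g where "g S = blinfun_apply (snd S) p + M" for S :: "'c dual set \<times> 'c dual"
      have g0: "0 \<le> g S" if "V S" for S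
        using that M[of "snd S"] by (auto simp: g_def V_def)
      have gstep: "V (L n S) \<and> V (R n S) \<and> 0 \<le> q n S \<and> q n S \<le> 1 \<and>
          g S = q n S * g (L n S) + (1 - q n S) * g (R n S)" if VS: "V S" for n S
      proof -
        have "blinfun_apply (snd S) p =
            q n S * blinfun_apply (snd (L n S)) p + (1 - q n S) * blinfun_apply (snd (R n S)) p"
          using arg_cong[OF conjunct1[OF conjunct2[OF conjunct2[OF st[OF VS, of n]]]], of "\<lambda>v. blinfun_apply v p"]
          by (simp add: blinfun.add_left blinfun.scaleR_left)
        then have "g S = q n S * g (L n S) + (1 - q n S) * g (R n S)"
          unfolding g_def by algebra
        then show ?thesis using st[OF VS, of n] by (simp add: child_def)
      qed
      have "(\<integral>\<^sup>+\<omega>. ennreal (g (W m \<omega>)) \<partial>?S) = ennreal (g (X, u))"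
        unfolding W_def by (rule nn_integral_walk[of V, OF V0 gstep g0])
      then have "(\<integral>\<omega>. g (W m \<omega>) \<partial>?S) = g (X, u)"
        using g0[OF VW] g0[OF V0] snd_m[of m]
        by (subst integral_eq_nn_integral) (auto simp: g_def)
      then show ?thesis
        using intW[of m] by (simp add: g_def S.prob_space)
    qed
    moreover have "(\<lambda>m. \<integral>\<omega>. blinfun_apply (snd (W m \<omega>)) p \<partial>?S) \<longlonglongrightarrow> (\<integral>\<omega>. blinfun_apply (f \<omega>) p \<partial>?S)"
    proof (rule integral_dominated_convergence[where w = "\<lambda>_. M"])
      show "(\<lambda>\<omega>. blinfun_apply (f \<omega>) p) \<in> borel_measurable ?S"
        by (rule measurable_compose[OF fm eval_measurable])
    qed (use snd_m conv bd in auto)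
    ultimately show ?thesis by (simp add: LIMSEQ_const_iff)
  qed
  show ?thesis
  proof (rule that[of "distr ?S (weak_star_borel X) f"])
    show "prob_space (distr ?S (weak_star_borel X) f)" by (rule S.prob_space_distr[OF fm])
    show "blinfun_apply u p = (\<integral>v. blinfun_apply v p \<partial>distr ?S (weak_star_borel X) f)" for p
      using int[of p] by (simp add: integral_distr[OF fm eval_measurable])
  qed simp
qed

section \<open>Finite combinations of Dirac measures\<close>

text \<open>All minimisers share one value, so the arbitrary choice made by \<open>arg_min\<close>
  does not matter.\<close>

lemma min_value_eq:
  assumes "is_arg_min f P x" shows "min_value f P = f x"
proof -
  have "is_arg_min f P (arg_min f P)"
    unfolding arg_min_def using assms by (rule someI)
  with assms show ?thesis unfolding min_value_def is_arg_min_def by (meson linorder_neqE)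
qed

lemma finite_cone_argmin:
  fixes F :: "'y::real_normed_vector \<Rightarrow> real" and K :: "'a \<Rightarrow> 'y"
  assumes A: "finite A" and F: "continuous_on UNIV F" "bdd_below (range F)"
  shows "\<exists>c. is_arg_min (\<lambda>c. F (\<Sum>w\<in>A. c w *\<^sub>R K w) + (\<Sum>w\<in>A. c w)) (\<lambda>c. \<forall>w\<in>A. 0 \<le> c w) c"
proof -
  define phi where "phi c = F (\<Sum>w\<in>A. c w *\<^sub>R K w) + (\<Sum>w\<in>A. c w)" for c
  obtain m where m: "\<And>y. m \<le> F y" using F(2) by (auto simp: bdd_below_def)
  \<comment> \<open>If the coefficients sum to more than \<open>M\<close>, the objective exceeds
    \<open>m + M = F 0\<close>, its value at zero.\<close>
  define M where "M = F 0 - m"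
  have M: "0 \<le> M" using m[of 0] by (simp add: M_def)
  \<comment> \<open>Coefficients are total functions; pinning them to 0 off \<open>A\<close> leaves
    the objective unchanged and makes the box compact.\<close>
  define Box where "Box = PiE UNIV (\<lambda>w. if w \<in> A then {0..M} else {0})"
  have zero: "(\<lambda>_. 0) \<in> Box" using M by (auto simp: Box_def)
  have "compactin (product_topology (\<lambda>_. euclideanreal) UNIV) Box"
    unfolding Box_def compactin_PiE by auto
  then have "compact Box" by (simp add: euclidean_product_topology)
  moreover have "continuous_on Box phi"
    unfolding phi_def
    by (intro continuous_on_add continuous_on_compose2[OF F(1)] continuous_on_sum continuous_on_scaleR
        continuous_on_const continuous_on_subset[OF continuous_on_product_coordinates]) auto
  ultimately obtain c0 where c0: "c0 \<in> Box" "\<And>c. c \<in> Box \<Longrightarrow> phi c0 \<le> phi c"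
    using continuous_attains_inf[of Box phi] zero by blast
  have "phi c0 \<le> phi c" if c: "\<forall>w\<in>A. 0 \<le> c w" for c
  proof (cases "(\<Sum>w\<in>A. c w) \<le> M")
    case True
    have le: "c w \<le> M" if "w \<in> A" for w
      using member_le_sum[of w A c] that c A True by auto
    define c' where "c' w = (if w \<in> A then c w else 0)" for w
    have "phi c' = phi c"
      by (simp add: phi_def c'_def)
    moreover have "c' \<in> Box" using c le by (auto simp: Box_def c'_def)
    ultimately show ?thesis using c0(2) by metis
  next
    case False
    then have "phi (\<lambda>_. 0) \<le> phi c"
      using m[of "\<Sum>w\<in>A. c w *\<^sub>R K w"] by (simp add: phi_def M_def)
    then show ?thesis using c0(2)[OF zero] by simp
  qed
  moreover have "\<forall>w\<in>A. 0 \<le> c0 w" using c0(1) by (auto simp: Box_def PiE_def Pi_def split: if_splits)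
  ultimately show ?thesis
    unfolding phi_def is_arg_min_def by (intro exI[of _ c0]) (auto simp: not_less)
qed

section \<open>Barycenters and Dirac combinations\<close>

lemma Iop_eqI: "(\<And>p. blinfun_apply u p = (\<integral>v. blinfun_apply v p \<partial>\<mu>)) \<Longrightarrow> Iop \<mu> = u"
  unfolding Iop_def by (rule the_equality) (auto intro: blinfun_eqI)

text \<open>Testing the barycenter identity at \<open>p = Kp y\<close> gives the defining identity
  of \<open>Kop\<close>.\<close>

lemma Kop_eqI:
  assumes adj: "\<And>y u. blinfun_apply u (Kp y) = inner (K u) y"
    and u: "\<And>p. blinfun_apply u p = (\<integral>v. blinfun_apply v p \<partial>\<mu>)"
  shows "Kop K \<mu> = K u"
  unfolding Kop_def
proof (rule the_equality)
  show *: "\<forall>y. inner (K u) y = (\<integral>v. inner (K v) y \<partial>\<mu>)"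
    unfolding adj[symmetric] using u by blast
  show "z = K u" if "\<forall>y. inner z y = (\<integral>v. inner (K v) y \<partial>\<mu>)" for z
    using that * by (metis vector_eq_ldot inner_commute)
qed

lemma Ext_subset_clExt: "Ext G \<subseteq> clExt G"
  unfolding clExt_def by (rule closure_of_subset) (simp add: strong_operator_topology_topspace)

lemma space_borel_clExt: "space (borel_clExt G) = clExt G"
  unfolding borel_clExt_def by (rule space_weak_star_borel)

lemma clExt_sets: "clExt G \<in> sets (borel_clExt G)"
  using sets.top[of "borel_clExt G"] by (simp add: space_borel_clExt)

lemma openin_sets_borel_clExt:
  "openin (subtopology weak_star (clExt G)) U \<Longrightarrow> U \<in> sets (borel_clExt G)"
  unfolding borel_clExt_def using openin_weak_star_subset[of "clExt G"] by auto

lemma eval_measurable_Mpos: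
  "\<mu> \<in> Mpos G \<Longrightarrow> (\<lambda>v. blinfun_apply v p) \<in> borel_measurable \<mu>"
  using eval_measurable[of p "clExt G"]
  by (simp add: Mpos_def borel_clExt_def[symmetric] cong: measurable_cong_sets)

lemma space_Mpos: "\<mu> \<in> Mpos G \<Longrightarrow> space \<mu> = clExt G"
  using sets_eq_imp_space_eq[of \<mu> "borel_clExt G"] by (simp add: Mpos_def space_borel_clExt)

text \<open>As a pushforward of a weighted counting measure, it reduces integrals to finite sums by
  the rules for image measures and densities. For given \<open>A\<close> and \<open>c\<close>,
  \<open>dirac_comb\<close> fixes the sigma-algebra and all values, so no other measure satisfies
  it.\<close>

definition dirac_measure ::
  "('c::real_normed_vector dual \<Rightarrow> ennreal) \<Rightarrow> 'c dual set \<Rightarrow> ('c dual \<Rightarrow> real) \<Rightarrow> 'c dual measure" where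
  "dirac_measure G A c = distr (density (count_space A) (\<lambda>w. ennreal (c w))) (borel_clExt G) (\<lambda>w. w)"

lemma id_measurable_density:
  "A \<subseteq> clExt G \<Longrightarrow> (\<lambda>w. w) \<in> measurable (density (count_space A) f) (borel_clExt G)"
  by (auto simp: space_borel_clExt)

lemma emeasure_dirac_measure:
  assumes A: "finite A" "A \<subseteq> clExt G" and E: "E \<in> sets (borel_clExt G)"
  shows "emeasure (dirac_measure G A c) E = (\<Sum>w\<in>A. ennreal (c w) * indicator E w)"
proof -
  have "emeasure (dirac_measure G A c) E = emeasure (density (count_space A) (\<lambda>w. ennreal (c w))) (E \<inter> A)"
    unfolding dirac_measure_def
    by (subst emeasure_distr[OF id_measurable_density[OF A(2)] E]) simp
  also have "\<dots> = (\<Sum>w\<in>A. ennreal (c w) * indicator (E \<inter> A) w)"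
    using A by (simp add: emeasure_density nn_integral_count_space_finite)
  finally show ?thesis by (simp add: indicator_def cong: sum.cong)
qed

lemma dirac_comb_dirac_measure:
  assumes A: "finite A" "A \<subseteq> clExt G"
  shows "dirac_comb G A c (dirac_measure G A c)"
proof -
  have s: "sets (dirac_measure G A c) = sets (borel_clExt G)" by (simp add: dirac_measure_def)
  have "finite_measure (dirac_measure G A c)"
  proof
    have "emeasure (dirac_measure G A c) (clExt G) \<noteq> \<infinity>"
      using emeasure_dirac_measure[OF A clExt_sets] A(1)
      by (auto simp: ennreal_mult_eq_top_iff indicator_def)
    then show "emeasure (dirac_measure G A c) (space (dirac_measure G A c)) \<noteq> \<infinity>"
      by (simp add: dirac_measure_def space_borel_clExt)
  qed
  then show ?thesis
    using emeasure_dirac_measure[OF A] s by (simp add: dirac_comb_def Mpos_def)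
qed

lemma dirac_comb_imp_eq:
  assumes A: "finite A" "A \<subseteq> clExt G" and \<mu>: "dirac_comb G A c \<mu>"
  shows "\<mu> = dirac_measure G A c"
proof (rule measure_eqI)
  show s: "sets \<mu> = sets (dirac_measure G A c)"
    using \<mu> by (simp add: dirac_comb_def Mpos_def dirac_measure_def)
  show "emeasure \<mu> E = emeasure (dirac_measure G A c) E" if "E \<in> sets \<mu>" for E
    using that \<mu> dirac_comb_dirac_measure[OF A, of c] s unfolding dirac_comb_def by metis
qed

lemma emeasure_dirac_comb:
  assumes "finite A" "A \<subseteq> clExt G" "dirac_comb G A c \<mu>" "E \<in> sets \<mu>"
  shows "emeasure \<mu> E = (\<Sum>w\<in>A. ennreal (c w) * indicator E w)"
  using assms emeasure_dirac_measure[OF assms(1,2)] dirac_comb_imp_eq[OF assms(1-3)]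
  by (simp add: dirac_comb_def Mpos_def)

lemma integral_eval_dirac_comb:
  assumes A: "finite A" "A \<subseteq> clExt G" and c: "\<And>w. w \<in> A \<Longrightarrow> 0 \<le> c w" and \<mu>: "dirac_comb G A c \<mu>"
  shows "(\<integral>v. blinfun_apply v p \<partial>\<mu>) = blinfun_apply (\<Sum>w\<in>A. c w *\<^sub>R w) p"
proof -
  have "(\<integral>v. blinfun_apply v p \<partial>\<mu>) =
      (\<integral>v. blinfun_apply v p \<partial>density (count_space A) (\<lambda>w. ennreal (c w)))"
    unfolding dirac_comb_imp_eq[OF A \<mu>] dirac_measure_def
    by (rule integral_distr[OF id_measurable_density[OF A(2)]])
      (simp add: borel_clExt_def eval_measurable)
  also have "\<dots> = (\<integral>v. c v *\<^sub>R blinfun_apply v p \<partial>count_space A)"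
    by (rule integral_density) (auto simp: c AE_count_space)
  also have "\<dots> = (\<Sum>w\<in>A. c w * blinfun_apply w p)"
    using A by (simp add: lebesgue_integral_count_space_finite)
  finally show ?thesis by (simp add: blinfun.sum_left blinfun.scaleR_left)
qed

lemma Iop_dirac_comb:
  assumes "finite A" "A \<subseteq> clExt G" "\<And>w. w \<in> A \<Longrightarrow> 0 \<le> c w" "dirac_comb G A c \<mu>"
  shows "Iop \<mu> = (\<Sum>w\<in>A. c w *\<^sub>R w)"
  by (rule Iop_eqI) (simp add: integral_eval_dirac_comb[OF assms])

lemma mass_dirac_comb:
  assumes A: "finite A" "A \<subseteq> clExt G" and c: "\<And>w. w \<in> A \<Longrightarrow> 0 \<le> c w" and \<mu>: "dirac_comb G A c \<mu>"
  shows "mass \<mu> = (\<Sum>w\<in>A. c w)"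
proof -
  have "space \<mu> = clExt G" using \<mu> by (simp add: dirac_comb_def space_Mpos)
  then have "emeasure \<mu> (space \<mu>) = (\<Sum>w\<in>A. ennreal (c w))"
    using A by (subst emeasure_dirac_comb[OF A \<mu> sets.top]) (auto simp: indicator_def intro!: sum.cong)
  also have "\<dots> = ennreal (\<Sum>w\<in>A. c w)" using c by simp
  finally show ?thesis using c by (simp add: mass_def measure_def sum_nonneg)
qed

text \<open>An atom of positive weight charges all its neighbourhoods. Conversely, the complement of
  these finitely many atoms is open, since finite sets are weak* closed, and it is null. Passing to
  the support therefore drops exactly the zero coefficients.\<close>

lemma msupp_dirac_comb:
  assumes A: "finite A" "A \<subseteq> clExt G" and c: "\<And>w. w \<in> A \<Longrightarrow> 0 \<le> c w" and \<mu>: "dirac_comb G A c \<mu>"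
  shows "msupp G \<mu> = A - {w \<in> A. c w = 0}"
proof (intro equalityI subsetI)
  have s: "sets \<mu> = sets (borel_clExt G)" using \<mu> by (simp add: dirac_comb_def Mpos_def)
  fix v
  {
    assume v: "v \<in> A - {w \<in> A. c w = 0}"
    have "0 < emeasure \<mu> U" if U: "openin (subtopology weak_star (clExt G)) U" "v \<in> U" for U
    proof -
      have "0 < ennreal (c v) * indicator U v" using v U(2) c[of v] by (simp add: less_le)
      also have "\<dots> \<le> (\<Sum>w\<in>A. ennreal (c w) * indicator U w)"
        using v A by (intro member_le_sum) auto
      also have "\<dots> = emeasure \<mu> U"
        using openin_sets_borel_clExt[OF U(1)] s by (subst emeasure_dirac_comb[OF A \<mu>]) auto
      finally show ?thesis .
    qed
    then show "v \<in> msupp G \<mu>" using v A(2) by (auto simp: msupp_def)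
  next
    assume v: "v \<in> msupp G \<mu>"
    let ?D = "A - {w \<in> A. c w = 0}"
    show "v \<in> ?D"
    proof (rule ccontr)
      assume "v \<notin> ?D"
      let ?U = "clExt G - ?D"
      have "\<forall>S :: 'a dual set. finite S \<longrightarrow> closedin weak_star S"
        using Hausdorff_imp_t1_space[OF Hausdorff_weak_star]
        by (simp add: t1_space_closedin_finite strong_operator_topology_topspace)
      then have "closedin weak_star ?D" using finite_Diff[OF A(1)] by blast
      then have "closedin (subtopology weak_star (clExt G)) ?D"
        using A(2) by (intro closedin_subset_topspace) auto
      then have U: "openin (subtopology weak_star (clExt G)) ?U"
        using openin_diff[OF openin_topspace]
        by (metis strong_operator_topology_topspace topspace_subtopology inf_top_left)
      have "emeasure \<mu> ?U = (\<Sum>w\<in>A. ennreal (c w) * indicator ?U w)"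
        using openin_sets_borel_clExt[OF U] s by (subst emeasure_dirac_comb[OF A \<mu>]) auto
      also have "\<dots> = 0" by (intro sum.neutral) (auto simp: indicator_def)
      finally have "emeasure \<mu> ?U = 0" .
      moreover have "0 < emeasure \<mu> ?U"
        using v U \<open>v \<notin> ?D\<close> unfolding msupp_def by blast
      ultimately show False by simp
    qed
  }
qed

section \<open>The minimal values of both problems\<close>

locale weak_star_gauge =
  fixes G :: "('c::real_normed_vector) dual \<Rightarrow> ennreal"
  assumes separable: "separable_space (euclidean :: 'c topology)"
    and G_convex: "ennreal_convex G"
    and G_hom: "positively_homogeneous G"
    and G_compact: "compactin weak_star {u. G u \<le> 1}"
begin

lemma convex_unit_ball: "convex {u. G u \<le> 1}"
  unfolding convex_alt
proof clarify
  fix u v and t :: real assume h: "G u \<le> 1" "G v \<le> 1" "0 \<le> t" "t \<le> 1"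
  have "G ((1 - t) *\<^sub>R u + t *\<^sub>R v) \<le> ennreal (1 - t) * G u + ennreal t * G v"
    using G_convex h by (simp add: ennreal_convex_def)
  also have "\<dots> \<le> ennreal (1 - t) * 1 + ennreal t * 1"
    using h by (intro add_mono mult_left_mono) auto
  also have "\<dots> = 1" using h by (simp add: ennreal_plus[symmetric] del: ennreal_plus)
  finally show "G ((1 - t) *\<^sub>R u + t *\<^sub>R v) \<le> 1" .
qed

lemma G_scaleR: "0 \<le> t \<Longrightarrow> G (t *\<^sub>R u) = ennreal t * G u"
  using G_hom by (simp add: positively_homogeneous_def)

lemma G_zero: "G 0 = 0"
  using G_scaleR[of 0 0] by simp

lemma G_scaleR_le:
  assumes "0 \<le> t" "G u \<le> 1" shows "G (t *\<^sub>R u) \<le> ennreal t"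
  using mult_left_mono[OF assms(2), of "ennreal t"] assms(1) by (simp add: G_scaleR)

lemma clExt_subset: "clExt G \<subseteq> {u. G u \<le> 1}"
  unfolding clExt_def
  by (rule closure_of_minimal[OF _ compactin_weak_star_imp_closedin[OF G_compact]])
    (auto simp: Ext_def extreme_point_of_def)

text \<open>\<open>Ext G\<close> need not be closed, so the maximiser comes from the extreme point
  argument on the ball. It makes the selection step well-posed and feeds
  \<open>dominated_by_clExt\<close>.\<close>

lemma Ext_attains_max:
  obtains v where "v \<in> Ext G" "\<And>u. G u \<le> 1 \<Longrightarrow> blinfun_apply u p \<le> blinfun_apply v p"
proof -
  have "0 \<in> {u. G u \<le> 1}" by (simp add: G_zero)
  then have ne: "{u. G u \<le> 1} \<noteq> {}" by blast
  obtain v where "v extreme_point_of {u. G u \<le> 1}"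
    "\<And>u. u \<in> {u. G u \<le> 1} \<Longrightarrow> blinfun_apply u p \<le> blinfun_apply v p"
    by (rule extreme_point_attains_max[OF separable G_compact ne, of p]) simp
  then show ?thesis by (intro that[of v]) (auto simp: Ext_def)
qed

text \<open>Krein--Milman in terms of support functions: every evaluation attains its maximum over
  the ball at an extreme point.\<close>

lemma dominated_by_clExt:
  assumes "G u \<le> 1" shows "dominated_by (clExt G) (blinfun_apply u)"
  unfolding dominated_by_def
proof (intro allI impI)
  fix p c assume le: "\<forall>x\<in>clExt G. blinfun_apply x p \<le> c"
  obtain v where "v \<in> Ext G" "\<And>u. G u \<le> 1 \<Longrightarrow> blinfun_apply u p \<le> blinfun_apply v p"
    using Ext_attains_max by blast
  then show "blinfun_apply u p \<le> c" using le assms Ext_subset_clExt[of G] by force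
qed

lemma representing_measure:
  assumes u: "G u \<le> 1" and t: "0 \<le> t"
  obtains \<mu> where "\<mu> \<in> Mpos G" "mass \<mu> = t"
    "\<And>p. blinfun_apply (t *\<^sub>R u) p = (\<integral>v. blinfun_apply v p \<partial>\<mu>)"
proof -
  have cl: "closedin weak_star (clExt G)" by (simp add: clExt_def)
  obtain \<nu> where \<nu>: "sets \<nu> = sets (borel_clExt G)" "prob_space \<nu>"
    "\<And>p. blinfun_apply u p = (\<integral>v. blinfun_apply v p \<partial>\<nu>)"
    using barycenter_measure[OF separable G_compact convex_unit_ball cl clExt_subset, of u]
      u dominated_by_clExt[OF u] unfolding borel_clExt_def by blast
  interpret \<nu>: prob_space \<nu> by fact
  let ?\<mu> = "scale_measure (ennreal t) \<nu>"
  show ?thesis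
  proof (rule that[of ?\<mu>])
    have "finite_measure ?\<mu>" by standard (simp add: ennreal_mult_eq_top_iff \<nu>.emeasure_space_1)
    then show "?\<mu> \<in> Mpos G" using \<nu>(1) by (simp add: Mpos_def)
    show "mass ?\<mu> = t" using t
      by (simp add: mass_def measure_def \<nu>.emeasure_space_1 space_scale_measure)
    show "blinfun_apply (t *\<^sub>R u) p = (\<integral>v. blinfun_apply v p \<partial>?\<mu>)" for p
    proof -
      have "?\<mu> = density \<nu> (\<lambda>_. ennreal t)"
        by (rule measure_eqI) (auto simp: emeasure_density_const)
      moreover have m: "(\<lambda>v. blinfun_apply v p) \<in> borel_measurable \<nu>"
        using eval_measurable_Mpos[of \<nu> G p] \<nu>(1) \<nu>.finite_measure_axioms by (simp add: Mpos_def)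
      ultimately show ?thesis
        using integral_density[OF m, of "\<lambda>_. t"] t \<nu>(3)[of p] by (simp add: blinfun.scaleR_left)
    qed
  qed
qed

text \<open>The normalised integral is linear in \<open>p\<close> and dominated by the unit ball,
  which contains \<open>clExt G\<close>, so \<open>dominated_by_represented\<close> turns it into a
  dual element. For mass zero the point 0 serves. This also shows that \<open>Iop\<close> is
  well-defined on \<open>Mpos G\<close>.\<close>

lemma Mpos_barycenter:
  assumes \<mu>: "\<mu> \<in> Mpos G"
  obtains u where "G u \<le> 1" "\<And>p. blinfun_apply (mass \<mu> *\<^sub>R u) p = (\<integral>v. blinfun_apply v p \<partial>\<mu>)"
proof -
  interpret finite_measure \<mu> using \<mu> by (simp add: Mpos_def)
  have int: "integrable \<mu> (\<lambda>v. blinfun_apply v p)" for p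
  proof -
    obtain M where "\<And>u. u \<in> {u. G u \<le> 1} \<Longrightarrow> \<bar>blinfun_apply u p\<bar> \<le> M"
      using compactin_eval_bounded[OF G_compact] by blast
    then show ?thesis using space_Mpos[OF \<mu>] clExt_subset
      by (intro integrable_const_bound[of _ M] AE_I2 eval_measurable_Mpos[OF \<mu>]) auto
  qed
  show ?thesis
  proof (cases "mass \<mu> = 0")
    case True
    then have "emeasure \<mu> (space \<mu>) = 0" by (simp add: mass_def emeasure_eq_measure)
    then have "AE v in \<mu>. blinfun_apply v p = 0" for p
      by (intro AE_I'[of "space \<mu>"]) auto
    then have "(\<integral>v. blinfun_apply v p \<partial>\<mu>) = 0" for p by (rule integral_eq_zero_AE)
    then show ?thesis using True G_zero by (intro that[of 0]) auto
  next
    case False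
    then have m: "mass \<mu> > 0" by (simp add: mass_def less_le)
    define l where "l p = (\<integral>v. blinfun_apply v p \<partial>\<mu>) / mass \<mu>" for p
    have "linear l"
      by (rule linearI) (simp_all add: l_def blinfun.add_right blinfun.scaleR_right int add_divide_distrib)
    moreover have "dominated_by {u. G u \<le> 1} l"
      unfolding dominated_by_def
    proof (intro allI impI)
      fix p c assume c: "\<forall>x\<in>{u. G u \<le> 1}. blinfun_apply x p \<le> c"
      have "(\<integral>v. blinfun_apply v p \<partial>\<mu>) \<le> (\<integral>v. c \<partial>\<mu>)"
        using c clExt_subset space_Mpos[OF \<mu>] by (intro integral_mono int) auto
      also have "\<dots> = c * mass \<mu>" by (simp add: mass_def)
      finally show "l p \<le> c" using m by (simp add: l_def divide_le_eq)
    qed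
    ultimately obtain u where "G u \<le> 1" "\<And>p. blinfun_apply u p = l p"
      using dominated_by_represented[OF G_compact convex_unit_ball] by blast
    then show ?thesis using m by (intro that[of u]) (auto simp: l_def blinfun.scaleR_left)
  qed
qed

end

section \<open>The composite objectives and attainment of their minima\<close>

locale conic_problem = weak_star_gauge G
  for G :: "('c::real_normed_vector) dual \<Rightarrow> ennreal" +
  fixes F :: "'y::real_inner \<Rightarrow> real" and K :: "'c dual \<Rightarrow> 'y" and Kp :: "'y \<Rightarrow> 'c"
  assumes K_linear: "linear K"
    and Kp_adjoint: "\<And>y u. blinfun_apply u (Kp y) = inner (K u) y"
    and F_bdd: "bdd_below (range F)"
    and F_cont: "continuous_on UNIV F"
    and K_strong: "\<And>U u. (\<And>k::nat. G (U k) < \<infinity>) \<Longrightarrow> limitin weak_star U u sequentially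
                     \<Longrightarrow> (\<lambda>k. K (U k)) \<longlonglongrightarrow> K u"
begin

lemma Kop_eq:
  assumes "\<mu> \<in> Mpos G" shows "Kop K \<mu> = K (Iop \<mu>)"
proof -
  obtain u where u: "\<And>p. blinfun_apply (mass \<mu> *\<^sub>R u) p = (\<integral>v. blinfun_apply v p \<partial>\<mu>)"
    using Mpos_barycenter[OF assms] by blast
  show ?thesis using Kop_eqI[of Kp K, OF Kp_adjoint u] Iop_eqI[OF u] by simp
qed

lemma G_Iop_le:
  assumes "\<mu> \<in> Mpos G" shows "G (Iop \<mu>) \<le> ennreal (mass \<mu>)"
proof -
  obtain u where u: "G u \<le> 1" "\<And>p. blinfun_apply (mass \<mu> *\<^sub>R u) p = (\<integral>v. blinfun_apply v p \<partial>\<mu>)"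
    using Mpos_barycenter[OF assms] by blast
  show ?thesis using Iop_eqI[OF u(2)] G_scaleR_le[OF _ u(1), of "mass \<mu>"] by (simp add: mass_def)
qed

text \<open>Strong convergence is available along weak* convergent sequences, so compactness is
  shown sequentially.\<close>

lemma compact_K_unit_ball: "compact (K ` {u. G u \<le> 1})"
  unfolding compact_def
proof (intro allI impI)
  fix f :: "nat \<Rightarrow> 'y" assume "\<forall>n. f n \<in> K ` {u. G u \<le> 1}"
  then have "\<forall>n. \<exists>u. G u \<le> 1 \<and> f n = K u" by blast
  then obtain U where "\<forall>n. G (U n) \<le> 1 \<and> f n = K (U n)"
    unfolding choice_iff by blast
  then have U: "\<And>n. U n \<in> {u. G u \<le> 1}" "\<And>n. f n = K (U n)" by auto
  obtain r u where r: "strict_mono (r :: nat \<Rightarrow> nat)" "u \<in> {u. G u \<le> 1}" "limitin weak_star (U \<circ> r) u sequentially"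
    by (rule weak_star_seq_compact[OF separable G_compact U(1)])
  have "G ((U \<circ> r) k) < \<infinity>" for k using U(1)[of "r k"] by (auto intro: le_less_trans)
  from K_strong[OF this r(3)] have "(f \<circ> r) \<longlonglongrightarrow> K u" using U(2) by (simp add: o_def)
  then show "\<exists>l\<in>K ` {u. G u \<le> 1}. \<exists>r. strict_mono r \<and> (f \<circ> r) \<longlonglongrightarrow> l"
    using r(1,2) by (intro bexI[of _ "K u"] exI[of _ r] conjI) auto
qed

text \<open>By linearity of \<open>K\<close> the objective depends on \<open>s\<close> and
  \<open>K u\<close> alone. The latter ranges over a norm compact set and \<open>F\<close> is
  continuous, so a minimiser exists once \<open>s\<close> is confined to
  \<open>{0..M}\<close>.\<close>

lemma radial_minimiser:
  obtains t v where "0 \<le> t" "G v \<le> 1"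
    "\<And>s u. 0 \<le> s \<Longrightarrow> G u \<le> 1 \<Longrightarrow> F (K (t *\<^sub>R v)) + t \<le> F (K (s *\<^sub>R u)) + s"
proof -
  obtain m where m: "\<And>y. m \<le> F y" using F_bdd by (auto simp: bdd_below_def)
  \<comment> \<open>For \<open>s > M\<close> the objective exceeds \<open>m + M = F 0\<close>, the
    value at \<open>(0, K 0)\<close>.\<close>
  define M where "M = F 0 - m"
  have M: "0 \<le> M" using m[of 0] by (simp add: M_def)
  let ?D = "{0..M} \<times> K ` {u. G u \<le> 1}"
  define phi where "phi x = F (fst x *\<^sub>R snd x) + fst x" for x
  have zero: "(0, K 0) \<in> ?D" using M G_zero by auto
  have "compact ?D" by (intro compact_Times compact_K_unit_ball) simp
  moreover have "continuous_on ?D phi"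
    unfolding phi_def
    by (intro continuous_on_add continuous_on_compose2[OF F_cont] continuous_intros) auto
  ultimately obtain x where x: "x \<in> ?D" "\<And>y. y \<in> ?D \<Longrightarrow> phi x \<le> phi y"
    using continuous_attains_inf[of ?D phi] zero by blast
  from x(1) obtain t v where tv: "x = (t, K v)" "0 \<le> t" "G v \<le> 1" by auto
  have "phi (t, K v) \<le> phi (s, K u)" if su: "0 \<le> s" "G u \<le> 1" for s u
  proof (cases "s \<le> M")
    case True
    then show ?thesis using x(2) su tv(1) by auto
  next
    case False
    then have "phi (0, K 0) \<le> phi (s, K u)" using m[of "s *\<^sub>R K u"] by (simp add: phi_def M_def)
    then show ?thesis using x(2)[OF zero] tv(1) by simp
  qed
  then show ?thesis using tv(2,3) by (intro that[of t v]) (auto simp: phi_def linear_cmul[OF K_linear])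
qed

text \<open>Both problems reduce to minimising \<open>F (K (t v)) + t\<close> over \<open>t \<ge> 0\<close> and \<open>v\<close> in the unit ball.\<close>
lemma minima:
  obtains m where
    "min_value (J_obj F K G) (\<lambda>_. True) = ereal m" "\<And>u. ereal m \<le> J_obj F K G u"
    "min_value (j_obj F K) (\<lambda>\<nu>. \<nu> \<in> Mpos G) = m"
proof -
  obtain t v where tv: "0 \<le> t" "G v \<le> 1"
    "\<And>s u. 0 \<le> s \<Longrightarrow> G u \<le> 1 \<Longrightarrow> F (K (t *\<^sub>R v)) + t \<le> F (K (s *\<^sub>R u)) + s"
    using radial_minimiser by blast
  define m where "m = F (K (t *\<^sub>R v)) + t"
  have J: "ereal m \<le> J_obj F K G u" for u
  proof (cases "G u = \<infinity>")
    case True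
    then show ?thesis by (simp add: J_obj_def)
  next
    case False
    define g where "g = enn2real (G u)"
    have g: "G u = ennreal g" "0 \<le> g" using False by (simp_all add: g_def less_top)
    \<comment> \<open>Rescaling by \<open>g + e\<close> instead of \<open>g\<close> brings
      \<open>u\<close> into the unit ball even when \<open>g = 0\<close>.\<close>
    have "m \<le> F (K u) + g + e" if e: "e > 0" for e
    proof -
      have s: "0 < g + e" using g e by simp
      have "G ((1 / (g + e)) *\<^sub>R u) = ennreal (1 / (g + e) * g)"
        using s g by (simp add: G_scaleR ennreal_mult[symmetric])
      also have "\<dots> \<le> 1" using s e by (simp add: divide_le_eq)
      finally have "F (K (t *\<^sub>R v)) + t \<le> F (K ((g + e) *\<^sub>R ((1 / (g + e)) *\<^sub>R u))) + (g + e)"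
        using s by (intro tv(3)) auto
      then show ?thesis using s by (simp add: m_def)
    qed
    then have "m \<le> F (K u) + g" by (rule field_le_epsilon)
    then show ?thesis using g by (simp add: J_obj_def enn2ereal_ennreal)
  qed
  have "J_obj F K G (t *\<^sub>R v) \<le> ereal m"
  proof -
    have "enn2ereal (G (t *\<^sub>R v)) \<le> enn2ereal (ennreal t)"
      using G_scaleR_le[OF tv(1,2)] by (simp add: less_eq_ennreal.rep_eq)
    then have "J_obj F K G (t *\<^sub>R v) \<le> ereal (F (K (t *\<^sub>R v))) + ereal t"
      unfolding J_obj_def using tv(1) by (intro add_mono) (auto simp: enn2ereal_ennreal)
    then show ?thesis by (simp add: m_def)
  qed
  then have Jm: "J_obj F K G (t *\<^sub>R v) = ereal m" using J by (simp add: antisym)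
  have "is_arg_min (J_obj F K G) (\<lambda>_. True) (t *\<^sub>R v)"
    using J by (auto simp: is_arg_min_def Jm not_less)
  from min_value_eq[OF this] have 1: "min_value (J_obj F K G) (\<lambda>_. True) = ereal m" by (simp add: Jm)
  have j: "m \<le> j_obj F K \<mu>" if \<mu>: "\<mu> \<in> Mpos G" for \<mu>
  proof -
    obtain u where u: "G u \<le> 1" "\<And>p. blinfun_apply (mass \<mu> *\<^sub>R u) p = (\<integral>v. blinfun_apply v p \<partial>\<mu>)"
      using Mpos_barycenter[OF \<mu>] by blast
    show ?thesis using tv(3)[OF _ u(1), of "mass \<mu>"] Kop_eq[OF \<mu>] Iop_eqI[OF u(2)]
      by (simp add: j_obj_def m_def mass_def)
  qed
  \<comment> \<open>A measure of mass exactly \<open>t\<close> with barycenter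
    \<open>t *\<^sub>R v\<close> reaches the lower bound \<open>m\<close>, so \<open>j_obj\<close>
    attains the same minimum.\<close>
  obtain \<mu> where \<mu>: "\<mu> \<in> Mpos G" "mass \<mu> = t"
    "\<And>p. blinfun_apply (t *\<^sub>R v) p = (\<integral>v. blinfun_apply v p \<partial>\<mu>)"
    using representing_measure[OF tv(2,1)] by blast
  have jm: "j_obj F K \<mu> = m" using Kop_eq[OF \<mu>(1)] Iop_eqI[OF \<mu>(3)] \<mu>(2) by (simp add: j_obj_def m_def)
  have "is_arg_min (j_obj F K) (\<lambda>\<nu>. \<nu> \<in> Mpos G) \<mu>"
    using j \<mu>(1) by (auto simp: is_arg_min_def jm not_less)
  from min_value_eq[OF this] have 2: "min_value (j_obj F K) (\<lambda>\<nu>. \<nu> \<in> Mpos G) = m" by (simp add: jm)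
  show ?thesis by (rule that[OF 1 J 2])
qed

text \<open>Both residuals subtract the same real \<open>m\<close>, so the upper bound reduces to
  comparing the objectives, which is \<open>G_Iop_le\<close>.\<close>

lemma residual_bounds:
  assumes \<mu>: "\<mu> \<in> Mpos G"
  shows "0 \<le> rJ F K G (Iop \<mu>)" "rJ F K G (Iop \<mu>) \<le> ereal (rj F K G \<mu>)"
proof -
  obtain m where m: "min_value (J_obj F K G) (\<lambda>_. True) = ereal m" "\<And>u. ereal m \<le> J_obj F K G u"
    "min_value (j_obj F K) (\<lambda>\<nu>. \<nu> \<in> Mpos G) = m"
    using minima by blast
  show "0 \<le> rJ F K G (Iop \<mu>)"
    unfolding rJ_def m(1) using m(2)[of "Iop \<mu>"] by (simp add: ereal_diff_positive)
  have "enn2ereal (G (Iop \<mu>)) \<le> enn2ereal (ennreal (mass \<mu>))"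
    using G_Iop_le[OF \<mu>] by (simp add: less_eq_ennreal.rep_eq)
  then have "J_obj F K G (Iop \<mu>) \<le> ereal (F (K (Iop \<mu>))) + ereal (mass \<mu>)"
    unfolding J_obj_def by (intro add_mono) (auto simp: enn2ereal_ennreal mass_def)
  then have "J_obj F K G (Iop \<mu>) \<le> ereal (j_obj F K \<mu>)"
    by (simp add: j_obj_def Kop_eq[OF \<mu>])
  then show "rJ F K G (Iop \<mu>) \<le> ereal (rj F K G \<mu>)"
    unfolding rJ_def rj_def m using ereal_minus_mono[of _ "ereal (j_obj F K \<mu>)" "ereal m" "ereal m"] by simp
qed

end

section \<open>Lifting of the algorithm\<close>

context conic_problem begin

lemma j_obj_dirac_comb:
  assumes A: "finite A" "A \<subseteq> clExt G" and c: "\<And>w. w \<in> A \<Longrightarrow> 0 \<le> c w" and \<mu>: "dirac_comb G A c \<mu>"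
  shows "j_obj F K \<mu> = F (\<Sum>w\<in>A. c w *\<^sub>R K w) + (\<Sum>w\<in>A. c w)"
proof -
  have "Kop K \<mu> = (\<Sum>w\<in>A. c w *\<^sub>R K w)"
    using Kop_eq[of \<mu>] \<mu> Iop_dirac_comb[OF assms]
    by (simp add: dirac_comb_def linear_sum[OF K_linear] linear_cmul[OF K_linear])
  then show ?thesis by (simp add: j_obj_def mass_dirac_comb[OF assms])
qed

lemma pdap_P_eq:
  "\<mu> \<in> Mpos G \<Longrightarrow> pdap_P F K Kp \<mu> = (\<lambda>v. blinfun_apply v (fcgcg_p F K Kp (Iop \<mu>)))"
  by (simp add: pdap_P_def fcgcg_p_def Kop_pre_def Kop_eq blinfun.minus_right)

lemma pdap_select_iff:
  "\<mu> \<in> Mpos G \<Longrightarrow> pdap_select F K Kp G \<mu> v \<longleftrightarrow> fcgcg_select F K Kp G (Iop \<mu>) v"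
  by (simp add: pdap_select_def fcgcg_select_def pdap_P_eq)

lemma pdap_stop_iff:
  "\<mu> \<in> Mpos G \<Longrightarrow> pdap_stop F K Kp k \<mu> v \<longleftrightarrow> fcgcg_stop F K Kp k (Iop \<mu>) v"
  by (simp add: pdap_stop_def fcgcg_stop_def pdap_P_eq)

lemma fcgcg_select_exists: "\<exists>v. fcgcg_select F K Kp G u v"
proof -
  obtain v where "v \<in> Ext G" "\<And>w. G w \<le> 1 \<Longrightarrow>
      blinfun_apply w (fcgcg_p F K Kp u) \<le> blinfun_apply v (fcgcg_p F K Kp u)"
    by (rule Ext_attains_max[of "fcgcg_p F K Kp u"]) simp
  then have "fcgcg_select F K Kp G u v"
    by (auto simp: fcgcg_select_def is_arg_max_def not_less Ext_def extreme_point_of_def)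
  then show ?thesis ..
qed

lemma fcgcg_select_in_Ext: "fcgcg_select F K Kp G u v \<Longrightarrow> v \<in> Ext G"
  by (simp add: fcgcg_select_def is_arg_max_def)

lemma fcgcg_update_exists:
  assumes "finite A" shows "\<exists>u' A'. fcgcg_update F K A v u' A'"
  using finite_cone_argmin[of "A \<union> {v}" F K] assms F_cont F_bdd
  by (simp add: fcgcg_update_def Let_def)

lemma fcgcg_update_active:
  assumes "fcgcg_update F K A v u' A'" "finite A" "A \<subseteq> Ext G" "v \<in> Ext G"
  shows "finite A' \<and> A' \<subseteq> Ext G"
  using assms by (auto simp: fcgcg_update_def Let_def)

text \<open>\<open>u'\<close> may have several coefficient vectors, so the measure is built from the
  very \<open>c\<close> that the update chose. Every competitor in \<open>Mpos_on\<close> takes the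
  value of its own coefficient vector, so optimality carries over.\<close>

lemma fcgcg_update_lift:
  assumes up: "fcgcg_update F K A v u' A'" and A: "finite A" "A \<subseteq> Ext G" and v: "v \<in> Ext G"
  shows "\<exists>\<mu>'. \<mu>' \<in> Mpos G \<and> u' = Iop \<mu>' \<and> pdap_update F K G A v \<mu>' A'"
proof -
  let ?A = "A \<union> {v}"
  let ?phi = "\<lambda>c. F (\<Sum>w\<in>?A. c w *\<^sub>R K w) + (\<Sum>w\<in>?A. c w)"
  have fin: "finite ?A" "?A \<subseteq> clExt G" using A v Ext_subset_clExt[of G] by auto
  obtain c where c: "is_arg_min ?phi (\<lambda>c. \<forall>w\<in>?A. 0 \<le> c w) c"
    "u' = (\<Sum>w\<in>?A. c w *\<^sub>R w)" "A' = ?A - {w \<in> ?A. c w = 0}"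
    using up unfolding fcgcg_update_def Let_def by (elim exE conjE) (rule that)
  then have pos: "\<And>w. w \<in> ?A \<Longrightarrow> 0 \<le> c w" unfolding is_arg_min_def by blast
  define \<mu> where "\<mu> = dirac_measure G ?A c"
  have \<mu>: "dirac_comb G ?A c \<mu>" unfolding \<mu>_def by (rule dirac_comb_dirac_measure[OF fin])
  have "is_arg_min (j_obj F K) (\<lambda>\<mu>. \<mu> \<in> Mpos_on G ?A) \<mu>"
    unfolding is_arg_min_def
  proof (intro conjI notI)
    show "\<mu> \<in> Mpos_on G ?A" using \<mu> pos unfolding Mpos_on_def by blast
    assume "\<exists>\<nu>. \<nu> \<in> Mpos_on G ?A \<and> j_obj F K \<nu> < j_obj F K \<mu>"
    then obtain \<nu> d where d: "\<forall>w\<in>?A. 0 \<le> d w" "dirac_comb G ?A d \<nu>" "j_obj F K \<nu> < j_obj F K \<mu>"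
      unfolding Mpos_on_def by blast
    have "?phi d < ?phi c"
      using d(3) j_obj_dirac_comb[OF fin pos \<mu>] j_obj_dirac_comb[OF fin _ d(2)] d(1) by simp
    then show False using c(1) d(1) unfolding is_arg_min_def by blast
  qed
  moreover have "A' = msupp G \<mu>" using msupp_dirac_comb[OF fin pos \<mu>] c(3) by simp
  moreover have "u' = Iop \<mu>" using Iop_dirac_comb[OF fin pos \<mu>] c(2) by simp
  moreover have "\<mu> \<in> Mpos G" using \<mu> by (simp add: dirac_comb_def)
  ultimately show ?thesis unfolding pdap_update_def by blast
qed

lemma one_step:
  assumes A: "finite A" "A \<subseteq> Ext G" and \<mu>: "\<mu> \<in> Mpos G"
  shows "\<exists>v u' \<mu>' A'. fcgcg_select F K Kp G (Iop \<mu>) v \<and> pdap_select F K Kp G \<mu> v \<and>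
    fcgcg_update F K A v u' A' \<and> pdap_update F K G A v \<mu>' A' \<and> u' = Iop \<mu>'"
proof -
  obtain v where v: "fcgcg_select F K Kp G (Iop \<mu>) v" using fcgcg_select_exists ..
  obtain u' A' where up: "fcgcg_update F K A v u' A'" using fcgcg_update_exists[OF A(1)] by blast
  from fcgcg_update_lift[OF up A fcgcg_select_in_Ext[OF v]] v up pdap_select_iff[OF \<mu>]
  show ?thesis by blast
qed

text \<open>\<open>pdap_update\<close> involves the active set and the new point but not the
  previous measure, so the measures of different steps can be chosen independently.\<close>

lemma run_lift:
  assumes run: "fcgcg_run F K Kp G T A u v"
    and init: "pdap_init G (A 0) \<mu>0" "u 0 = Iop \<mu>0"
  obtains \<mu> where "pdap_run F K Kp G T A \<mu> v" "\<mu> 0 = \<mu>0"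
    "\<And>k. enat k \<le> T \<Longrightarrow> \<mu> k \<in> Mpos G \<and> u k = Iop (\<mu> k)"
proof -
  have sel: "fcgcg_select F K Kp G (u k) (v k)" if "enat k \<le> T" for k
    using run that by (simp add: fcgcg_run_def)
  have stop: "fcgcg_stop F K Kp k (u k) (v k) \<longleftrightarrow> T = enat k" if "enat k \<le> T" for k
    using run that by (simp add: fcgcg_run_def)
  have up: "fcgcg_update F K (A k) (v k) (u (Suc k)) (A (Suc k))" if "enat k < T" for k
    using run that by (simp add: fcgcg_run_def)
  have A: "finite (A k) \<and> A k \<subseteq> Ext G" if "enat k \<le> T" for k
    using that
  proof (induction k)
    case 0
    then show ?case using init by (simp add: pdap_init_def)
  next
    case (Suc k)
    then have "enat k < T" by (simp add: Suc_ile_eq)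
    then show ?case
      using fcgcg_update_active[OF up] Suc.IH fcgcg_select_in_Ext[OF sel] by simp
  qed
  have lift: "\<exists>\<mu>'. enat k < T \<longrightarrow> \<mu>' \<in> Mpos G \<and> u (Suc k) = Iop \<mu>' \<and>
      pdap_update F K G (A k) (v k) \<mu>' (A (Suc k))" for k
  proof (cases "enat k < T")
    case True
    then show ?thesis
      using fcgcg_update_lift[OF up] A[of k] fcgcg_select_in_Ext[OF sel[of k]] by simp
  qed simp
  then obtain \<nu> where \<nu>: "\<forall>k. enat k < T \<longrightarrow> \<nu> k \<in> Mpos G \<and> u (Suc k) = Iop (\<nu> k) \<and>
      pdap_update F K G (A k) (v k) (\<nu> k) (A (Suc k))"
    using choice[of "\<lambda>k \<mu>'. enat k < T \<longrightarrow> \<mu>' \<in> Mpos G \<and> u (Suc k) = Iop \<mu>' \<and>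
      pdap_update F K G (A k) (v k) \<mu>' (A (Suc k))"] by blast
  \<comment> \<open>\<open>\<nu> k\<close> is produced by step \<open>k\<close> and hence belongs to
    index \<open>Suc k\<close>.\<close>
  define \<mu> where "\<mu> = case_nat \<mu>0 \<nu>"
  have \<mu>: "\<mu> k \<in> Mpos G \<and> u k = Iop (\<mu> k)" if "enat k \<le> T" for k
    using that \<nu> init by (cases k) (auto simp: \<mu>_def Suc_ile_eq pdap_init_def dirac_comb_def)
  have "pdap_run F K Kp G T A \<mu> v"
    unfolding pdap_run_def
  proof (intro conjI allI impI)
    show "pdap_init G (A 0) (\<mu> 0)" using init by (simp add: \<mu>_def)
    show "pdap_select F K Kp G (\<mu> k) (v k)" if "enat k \<le> T" for k
      using sel[OF that] \<mu>[OF that] pdap_select_iff by simp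
    show "pdap_stop F K Kp k (\<mu> k) (v k) \<longleftrightarrow> T = enat k" if "enat k \<le> T" for k
      using stop[OF that] \<mu>[OF that] pdap_stop_iff by simp
    show "pdap_update F K G (A k) (v k) (\<mu> (Suc k)) (A (Suc k))" if "enat k < T" for k
      using \<nu> that by (simp add: \<mu>_def)
  qed
  then show ?thesis using \<mu> by (intro that[of \<mu>]) (auto simp: \<mu>_def)
qed

end

theorem theorem5p10:
  fixes F :: "'y::{real_inner, banach} \<Rightarrow> real"
    and K :: "'c::banach dual \<Rightarrow> 'y"
    and Kp :: "'y \<Rightarrow> 'c"
    and G :: "'c dual \<Rightarrow> ennreal"
  assumes separable: "separable_space (euclidean :: 'c topology)"
    and K_linear: "linear K"
    and K_weak: "continuous_map weak_star weak_topology K"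
    and Kp_bounded: "bounded_linear Kp"
    and Kp_adjoint: "\<And>y u. blinfun_apply u (Kp y) = inner (K u) y"
    and F_convex: "convex_on UNIV F"
    and G_convex: "ennreal_convex G"
    and G_lsc: "weak_star_lsc G"
    and G_hom: "positively_homogeneous G"
    and F_bdd: "bdd_below (range F)"
    and F_strict: "strictly_convex F"
    and F_diff: "\<And>y. F differentiable (at y)"
    and F_lip: "\<And>S. compact S \<Longrightarrow> \<exists>L. L-lipschitz_on S (gradient F)"
    and G_compact: "\<And>\<alpha>::real. 0 \<le> \<alpha> \<Longrightarrow> compactin weak_star {u. G u \<le> ennreal \<alpha>}"
    and K_strong: "\<And>U u. (\<And>k::nat. G (U k) < \<infinity>) \<Longrightarrow> limitin weak_star U u sequentially
                     \<Longrightarrow> (\<lambda>k. K (U k)) \<longlonglongrightarrow> K u"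
  shows
    "(\<forall>k A \<mu>. finite A \<longrightarrow> A \<subseteq> Ext G \<longrightarrow> \<mu> \<in> Mpos_on G A \<longrightarrow>
        (\<exists>vu v\<mu> u' \<mu>' Au' A\<mu>'.
            fcgcg_select F K Kp G (Iop \<mu>) vu \<and> pdap_select F K Kp G \<mu> v\<mu> \<and>
            (fcgcg_stop F K Kp k (Iop \<mu>) vu \<longleftrightarrow> pdap_stop F K Kp k \<mu> v\<mu>) \<and>
            fcgcg_update F K A vu u' Au' \<and> pdap_update F K G A v\<mu> \<mu>' A\<mu>' \<and>
            vu = v\<mu> \<and> u' = Iop \<mu>' \<and> Au' = A\<mu>'))
     \<and>
     (\<forall>T Au u vu A0 \<mu>0.
        fcgcg_run F K Kp G T Au u vu \<longrightarrow> pdap_init G A0 \<mu>0 \<longrightarrow>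
        u 0 = Iop \<mu>0 \<longrightarrow> Au 0 = A0 \<longrightarrow>
        (\<exists>A\<mu> \<mu> v\<mu>. pdap_run F K Kp G T A\<mu> \<mu> v\<mu> \<and> A\<mu> 0 = A0 \<and> \<mu> 0 = \<mu>0 \<and>
          (\<forall>k. enat k \<le> T \<longrightarrow>
             u k = Iop (\<mu> k) \<and> Au k = A\<mu> k \<and> vu k = v\<mu> k \<and>
             0 \<le> rJ F K G (u k) \<and> rJ F K G (u k) \<le> ereal (rj F K G (\<mu> k)))))"
proof -
  interpret conic_problem G F K Kp
  proof (intro conic_problem.intro weak_star_gauge.intro conic_problem_axioms.intro)
    show "compactin weak_star {u. G u \<le> 1}" using G_compact[of 1] by simp
    show "continuous_on UNIV F"
      using F_diff by (intro continuous_at_imp_continuous_on ballI differentiable_imp_continuous_within)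
  qed (rule separable G_convex G_hom K_linear Kp_adjoint F_bdd K_strong; assumption?)+
  show ?thesis
  proof (intro conjI allI impI)
    fix k A \<mu>
    assume A: "finite A" "A \<subseteq> Ext G" and "\<mu> \<in> Mpos_on G A"
    then have \<mu>: "\<mu> \<in> Mpos G" by (auto simp: Mpos_on_def dirac_comb_def)
    show "\<exists>vu v\<mu> u' \<mu>' Au' A\<mu>'.
            fcgcg_select F K Kp G (Iop \<mu>) vu \<and> pdap_select F K Kp G \<mu> v\<mu> \<and>
            (fcgcg_stop F K Kp k (Iop \<mu>) vu \<longleftrightarrow> pdap_stop F K Kp k \<mu> v\<mu>) \<and>
            fcgcg_update F K A vu u' Au' \<and> pdap_update F K G A v\<mu> \<mu>' A\<mu>' \<and>
            vu = v\<mu> \<and> u' = Iop \<mu>' \<and> Au' = A\<mu>'"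
      using one_step[OF A \<mu>] pdap_stop_iff[OF \<mu>] by blast
  next
    fix T Au u vu A0 \<mu>0
    assume run: "fcgcg_run F K Kp G T Au u vu" and init: "pdap_init G A0 \<mu>0" "u 0 = Iop \<mu>0" "Au 0 = A0"
    obtain \<mu> where \<mu>: "pdap_run F K Kp G T Au \<mu> vu" "\<mu> 0 = \<mu>0"
      "\<And>k. enat k \<le> T \<Longrightarrow> \<mu> k \<in> Mpos G \<and> u k = Iop (\<mu> k)"
      by (rule run_lift[OF run, of \<mu>0]) (use init in auto)
    show "\<exists>A\<mu> \<mu> v\<mu>. pdap_run F K Kp G T A\<mu> \<mu> v\<mu> \<and> A\<mu> 0 = A0 \<and> \<mu> 0 = \<mu>0 \<and>
          (\<forall>k. enat k \<le> T \<longrightarrow>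
             u k = Iop (\<mu> k) \<and> Au k = A\<mu> k \<and> vu k = v\<mu> k \<and>
             0 \<le> rJ F K G (u k) \<and> rJ F K G (u k) \<le> ereal (rj F K G (\<mu> k)))"
    proof (intro exI[of _ Au] exI[of _ \<mu>] exI[of _ vu] conjI allI impI)
      fix k assume "enat k \<le> T"
      from \<mu>(3)[OF this] show "u k = Iop (\<mu> k)" "0 \<le> rJ F K G (u k)"
        "rJ F K G (u k) \<le> ereal (rj F K G (\<mu> k))"
        using residual_bounds[of "\<mu> k"] by auto
    qed (use \<mu> init in auto)
  qed
qed

end
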